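(* Let $0 \to S \xrightarrow{j} E \xrightarrow{q} Q \to 0$ be a short exact sequence of holomorphic vector bundles over a complex manifold $X$, let $b_E$ be a smooth Hermitian form on $E$, and let $b_S$ and $b_Q$ be the induced Hermitian forms on $S$ and $Q$. Let $\sigma$ be the second fundamental form of $S$ in $E$, $\sigma^\dagger$ an adjoint of $\sigma$, and $q^\dagger$ an adjoint of $q$. Then the curvature tensors $R_S, R_E, R_Q$ of $b_S, b_E, b_Q$ satisfy $$R_S(\alpha,\overline\beta,s,\overline t) = R_E(\alpha,\overline\beta,js,\overline{jt}) - b_Q\bigl(\sigma(\alpha,s),\overline{\sigma(\beta,t)}\bigr)$$ for all $(1,0)$ tangent fields $\alpha,\beta$ and all sections $s,t$ of $S$, and $$R_Q(\alpha,\overline\beta,s,\overline t) = R_E(\alpha,\overline\beta,q^\dagger s,\overline{q^\dagger t}) + b_S\bigl(\sigma^\dagger(\overline\beta,s),\overline{\sigma^\dagger(\overline\alpha,t)}\bigr)$$ for all $(1,0)$ tangent fields $\alpha,\beta$ and all sections $s,t$ of $Q$.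
   Context: Hermitian forms are possibly degenerate; $b(s,\overline t)$ is linear in $s$ and conjugate linear in $t$. For a Hermitian form $b$ on a vector space $V$, $\mathrm{Ker}\, b = \{x : b(x,\overline y)=0 \text{ for all } y\in V\}$. Induced forms: $b_S = j^*b_E$. Identify $S$ with $j(S)\subset E$ and let $S^\perp = \{v\in E : b_E(v,\overline w)=0 \text{ for all } w\in S\}$ (fiberwise). It is a standing fact of the setting that $S+S^\perp = E$ and $S\cap S^\perp = S\cap \mathrm{Ker}\, b_E$ in each fiber, so $q|_{S^\perp}$ is surjective onto $Q$ with kernel contained in $\mathrm{Ker}\, b_E$; $b_Q$ is then the well-defined form with $b_Q(qx,\overline{qy}) = b_E(x,\overline y)$ for $x,y\in S^\perp$. Adjoints: an adjoint of a bundle morphism $f:(V,b_V)\to(W,b_W)$ is a smooth bundle morphism $f^\dagger: W\to V$ with $b_V(f^\dagger x,\overline y)=b_W(x,\overline{fy})$ for all $x \in W$, $y \in V$; it need not be unique. The adjoint of a form with values in $\mathrm{Hom}(V,W)$ is obtained by also conjugating the form part, so for a $(1,0)$-form $\sigma$ the adjoint $\sigma^\dagger$ is a $(0,1)$-form with $\sigma^\dagger(\overline\alpha,\cdot) = (\sigma(\alpha,\cdot))^\dagger$. It is a standing fact of the setting that adjoints $j^\dagger,q^\dagger,\sigma^\dagger$ exist. A Chern connection of a smooth Hermitian form $b$ on a holomorphic bundle is a connection $D$ with $d\,b(s,\overline t)=b(Ds,\overline t)+b(s,\overline{Dt})$ for all smooth sections and with $(0,1)$-part $\bar\partial$. Let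 $D_S,D_E,D_Q$ be Chern connections of $b_S,b_E,b_Q$ (assumed chosen). Second fundamental form: $\sigma(s) = q(D_E(js) - jD_S(s))$, a $(1,0)$-form with values in $\mathrm{Hom}(S,Q)$; $\sigma(\alpha,s)$ is its value on the $(1,0)$-vector $\alpha$ applied to $s$, and similarly for $\sigma^\dagger(\overline\beta,s)$. Curvature tensor: the curvature tensor $R$ of $b$ with Chern connection $D$ is the tensor associated with $b(\tfrac i2 D^2 s,\overline t)$ under the identification of a $(1,1)$-form $\tfrac i2\sum a_{jk}\,dz_j\wedge d\overline z_k$ with the sesquilinear form $(\alpha,\overline\beta)\mapsto\sum a_{jk}\alpha_j\overline\beta_k$; that is, $R(\alpha,\overline\beta,s,\overline t)=b(D^2(\alpha,\overline\beta)s,\overline t)$ with the normalization $(dz_j\wedge d\overline z_k)(\alpha,\overline\beta)=\alpha_j\overline\beta_k$. It does not depend on the choice of Chern connection. *)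

theory Defs
  imports "HOL-Analysis.Analysis"
begin

section \<open>Complex vector spaces\<close>

class complex_vector = ab_group_add +
  fixes scaleC :: "complex \<Rightarrow> 'a \<Rightarrow> 'a" (infixr \<open>*\<^sub>C\<close> 75)
  assumes scaleC_add_right: "a *\<^sub>C (x + y) = a *\<^sub>C x + a *\<^sub>C y"
    and scaleC_add_left: "(a + b) *\<^sub>C x = a *\<^sub>C x + b *\<^sub>C x"
    and scaleC_scaleC: "a *\<^sub>C (b *\<^sub>C x) = (a * b) *\<^sub>C x"
    and scaleC_one: "1 *\<^sub>C x = x"

global_interpretation complex_vector: vector_space "scaleC :: complex \<Rightarrow> 'a \<Rightarrow> 'a::complex_vector"
  by unfold_locales (rule scaleC_add_right scaleC_add_left scaleC_scaleC scaleC_one)+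

definition clinear_between ::
  "'a::complex_vector set \<Rightarrow> 'b::complex_vector set \<Rightarrow> ('a \<Rightarrow> 'b) \<Rightarrow> bool"
  where "clinear_between V W f \<longleftrightarrow>
    f ` V \<subseteq> W \<and>
    (\<forall>u\<in>V. \<forall>v\<in>V. f (u + v) = f u + f v) \<and>
    (\<forall>c. \<forall>u\<in>V. f (c *\<^sub>C u) = c *\<^sub>C f u)"


section \<open>Smooth and holomorphic functions on open subsets of complex n-space\<close>

text \<open>For open \<open>U\<close> in a finite-dimensional space, \<open>C_diff k U f\<close> says that \<open>f\<close> is \<open>k\<close> times
  continuously (real) differentiable on \<open>U\<close>.\<close>

primrec C_diff ::
  "nat \<Rightarrow> 'a::real_normed_vector set \<Rightarrow> ('a \<Rightarrow> 'b::real_normed_vector) \<Rightarrow> bool"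
  where
    "C_diff 0 U f \<longleftrightarrow> continuous_on U f"
  | "C_diff (Suc k) U f \<longleftrightarrow>
      (\<forall>x\<in>U. f differentiable (at x)) \<and>
      (\<forall>v. C_diff k U (\<lambda>x. frechet_derivative f (at x) v))"

definition C_infinity :: "'a::real_normed_vector set \<Rightarrow> ('a \<Rightarrow> 'b::real_normed_vector) \<Rightarrow> bool"
  where "C_infinity U f \<longleftrightarrow> (\<forall>k. C_diff k U f)"

definition wirtinger :: "'n::finite \<Rightarrow> (complex ^ 'n \<Rightarrow> complex) \<Rightarrow> complex ^ 'n \<Rightarrow> complex"
  where "wirtinger i g z =
    (frechet_derivative g (at z) (axis i 1) - \<i> * frechet_derivative g (at z) (axis i \<i>)) / 2"

definition wirtinger_bar :: "'n::finite \<Rightarrow> (complex ^ 'n \<Rightarrow> complex) \<Rightarrow> complex ^ 'n \<Rightarrow> complex"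
  where "wirtinger_bar i g z =
    (frechet_derivative g (at z) (axis i 1) + \<i> * frechet_derivative g (at z) (axis i \<i>)) / 2"

definition holomorphic_Cn :: "(complex ^ 'n::finite) set \<Rightarrow> (complex ^ 'n \<Rightarrow> complex) \<Rightarrow> bool"
  where "holomorphic_Cn U g \<longleftrightarrow> C_infinity U g \<and> (\<forall>z\<in>U. \<forall>i. wirtinger_bar i g z = 0)"


section \<open>Complex manifolds\<close>

text \<open>The manifold is the whole type \<open>'x\<close> with its topology; a chart is a pair of its domain and
  its coordinate map.\<close>

type_synonym ('x, 'n) chart = "'x set \<times> ('x \<Rightarrow> complex ^ 'n)"

definition complex_manifold :: "('x::t2_space, 'n::finite) chart set \<Rightarrow> bool"
  where "complex_manifold A \<longleftrightarrow>
    (\<Union>(U, \<phi>)\<in>A. U) = UNIV \<and>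
    (\<forall>(U, \<phi>)\<in>A. open U \<and> open (\<phi> ` U) \<and> (\<exists>\<psi>. homeomorphism U (\<phi> ` U) \<phi> \<psi>)) \<and>
    (\<forall>(U, \<phi>)\<in>A. \<forall>(V, \<psi>)\<in>A. \<forall>i.
      holomorphic_Cn (\<phi> ` (U \<inter> V)) (\<lambda>z. \<psi> (inv_into U \<phi> z) $ i))"

definition smooth_fun ::
  "('x::t2_space, 'n::finite) chart set \<Rightarrow> 'x set \<Rightarrow> ('x \<Rightarrow> complex) \<Rightarrow> bool"
  where "smooth_fun A W f \<longleftrightarrow>
    (\<forall>(U, \<phi>)\<in>A. C_infinity (\<phi> ` (U \<inter> W)) (\<lambda>z. f (inv_into U \<phi> z)))"

definition holomorphic_fun ::
  "('x::t2_space, 'n::finite) chart set \<Rightarrow> 'x set \<Rightarrow> ('x \<Rightarrow> complex) \<Rightarrow> bool"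
  where "holomorphic_fun A W f \<longleftrightarrow>
    (\<forall>(U, \<phi>)\<in>A. holomorphic_Cn (\<phi> ` (U \<inter> W)) (\<lambda>z. f (inv_into U \<phi> z)))"

definition smooth_near ::
  "('x::t2_space, 'n::finite) chart set \<Rightarrow> 'x \<Rightarrow> ('x \<Rightarrow> complex) \<Rightarrow> bool"
  where "smooth_near A x f \<longleftrightarrow> (\<exists>W. open W \<and> x \<in> W \<and> smooth_fun A W f)"


section \<open>Complexified tangent vectors\<close>

text \<open>A complex tangent vector at \<open>x\<close> is a differential operator
  \<open>\<Sum>i. a\<^sub>i \<partial>/\<partial>z\<^sub>i + b\<^sub>i \<partial>/\<partial>z\<^sub>i\<close>-bar on functions that are smooth near \<open>x\<close>. Setting it to \<open>0\<close>
  on all other functions makes equality of operators the same as equality of tangent vectors.\<close>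

type_synonym 'x tvec = "('x \<Rightarrow> complex) \<Rightarrow> complex"

definition coord_tvec ::
  "('x::t2_space, 'n::finite) chart set \<Rightarrow> ('x, 'n) chart \<Rightarrow> 'x \<Rightarrow>
    complex ^ 'n \<Rightarrow> complex ^ 'n \<Rightarrow> 'x tvec"
  where "coord_tvec A c x a b = (\<lambda>f.
    if smooth_near A x f then
      (\<Sum>i\<in>UNIV.
        a $ i * wirtinger i (\<lambda>z. f (inv_into (fst c) (snd c) z)) (snd c x) +
        b $ i * wirtinger_bar i (\<lambda>z. f (inv_into (fst c) (snd c) z)) (snd c x))
    else 0)"

definition tangent :: "('x::t2_space, 'n::finite) chart set \<Rightarrow> 'x \<Rightarrow> 'x tvec set"
  where "tangent A x = {coord_tvec A c x a b | c a b. c \<in> A \<and> x \<in> fst c}"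

definition tangent10 :: "('x::t2_space, 'n::finite) chart set \<Rightarrow> 'x \<Rightarrow> 'x tvec set"
  where "tangent10 A x = {coord_tvec A c x a 0 | c a. c \<in> A \<and> x \<in> fst c}"

definition tangent01 :: "('x::t2_space, 'n::finite) chart set \<Rightarrow> 'x \<Rightarrow> 'x tvec set"
  where "tangent01 A x = {coord_tvec A c x 0 b | c b. c \<in> A \<and> x \<in> fst c}"

definition conj_tvec :: "'x tvec \<Rightarrow> 'x tvec"
  where "conj_tvec v = (\<lambda>f. cnj (v (\<lambda>y. cnj (f y))))"

definition smooth_field ::
  "('x::t2_space, 'n::finite) chart set \<Rightarrow> 'x set \<Rightarrow> ('x \<Rightarrow> 'x tvec) \<Rightarrow> bool"
  where "smooth_field A U \<xi> \<longleftrightarrow>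
    (\<forall>x\<in>U. \<xi> x \<in> tangent A x) \<and>
    (\<forall>W f. open W \<and> W \<subseteq> U \<and> smooth_fun A W f \<longrightarrow> smooth_fun A W (\<lambda>x. \<xi> x f))"

definition smooth_field10 ::
  "('x::t2_space, 'n::finite) chart set \<Rightarrow> 'x set \<Rightarrow> ('x \<Rightarrow> 'x tvec) \<Rightarrow> bool"
  where "smooth_field10 A U \<xi> \<longleftrightarrow> smooth_field A U \<xi> \<and> (\<forall>x\<in>U. \<xi> x \<in> tangent10 A x)"

definition lie_bracket ::
  "('x::t2_space, 'n::finite) chart set \<Rightarrow> ('x \<Rightarrow> 'x tvec) \<Rightarrow> ('x \<Rightarrow> 'x tvec) \<Rightarrow> 'x \<Rightarrow> 'x tvec"
  where "lie_bracket A \<xi> \<eta> x = (\<lambda>f.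
    if smooth_near A x f then \<xi> x (\<lambda>y. \<eta> y f) - \<eta> x (\<lambda>y. \<xi> y f) else 0)"


section \<open>Holomorphic vector bundles\<close>

text \<open>A bundle is a family of complex vector spaces \<open>fiber E x\<close>, realised as subspaces of one
  complex vector space (this is no restriction: take the direct sum of all fibers), together with
  local trivialisations. A local trivialisation \<open>(U, r, e)\<close> over \<open>U\<close> of rank \<open>r\<close> is given by its
  local frame \<open>e 0, ..., e (r - 1)\<close>.\<close>

type_synonym ('x, 'v) frame = "'x set \<times> nat \<times> (nat \<Rightarrow> 'x \<Rightarrow> 'v)"

record ('x, 'v) vbundle =
  fiber :: "'x \<Rightarrow> 'v set"
  frames :: "('x, 'v) frame set"

definition coord_space :: "nat \<Rightarrow> (nat \<Rightarrow> complex) set"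
  where "coord_space r = {c. \<forall>i\<ge>r. c i = 0}"

definition frame_comb ::
  "nat \<Rightarrow> (nat \<Rightarrow> 'x \<Rightarrow> 'v::complex_vector) \<Rightarrow> 'x \<Rightarrow> (nat \<Rightarrow> complex) \<Rightarrow> 'v"
  where "frame_comb r e x c = (\<Sum>i<r. c i *\<^sub>C e i x)"

definition frame_coord ::
  "nat \<Rightarrow> (nat \<Rightarrow> 'x \<Rightarrow> 'v::complex_vector) \<Rightarrow> 'x \<Rightarrow> 'v \<Rightarrow> nat \<Rightarrow> complex"
  where "frame_coord r e x v = the_inv_into (coord_space r) (frame_comb r e x) v"

definition smooth_section ::
  "('x::t2_space, 'n::finite) chart set \<Rightarrow> ('x, 'v::complex_vector) vbundle \<Rightarrow>
    'x set \<Rightarrow> ('x \<Rightarrow> 'v) \<Rightarrow> bool"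
  where "smooth_section A E U s \<longleftrightarrow>
    (\<forall>x\<in>U. s x \<in> fiber E x) \<and>
    (\<forall>(V, r, e)\<in>frames E. \<forall>i<r. smooth_fun A (U \<inter> V) (\<lambda>x. frame_coord r e x (s x) i))"

definition holomorphic_section ::
  "('x::t2_space, 'n::finite) chart set \<Rightarrow> ('x, 'v::complex_vector) vbundle \<Rightarrow>
    'x set \<Rightarrow> ('x \<Rightarrow> 'v) \<Rightarrow> bool"
  where "holomorphic_section A E U s \<longleftrightarrow>
    (\<forall>x\<in>U. s x \<in> fiber E x) \<and>
    (\<forall>(V, r, e)\<in>frames E. \<forall>i<r. holomorphic_fun A (U \<inter> V) (\<lambda>x. frame_coord r e x (s x) i))"

text \<open>The last clause says that the transition matrices between local frames are holomorphic.\<close>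

definition holomorphic_bundle ::
  "('x::t2_space, 'n::finite) chart set \<Rightarrow> ('x, 'v::complex_vector) vbundle \<Rightarrow> bool"
  where "holomorphic_bundle A E \<longleftrightarrow>
    (\<forall>x. complex_vector.subspace (fiber E x)) \<and>
    (\<Union>(U, r, e)\<in>frames E. U) = UNIV \<and>
    (\<forall>(U, r, e)\<in>frames E. open U \<and>
      (\<forall>x\<in>U. bij_betw (frame_comb r e x) (coord_space r) (fiber E x)) \<and>
      (\<forall>k<r. holomorphic_section A E U (e k)))"

definition smooth_morphism ::
  "('x::t2_space, 'n::finite) chart set \<Rightarrow> ('x, 'v::complex_vector) vbundle \<Rightarrow>
    ('x, 'w::complex_vector) vbundle \<Rightarrow> ('x \<Rightarrow> 'v \<Rightarrow> 'w) \<Rightarrow> bool"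
  where "smooth_morphism A V W f \<longleftrightarrow>
    (\<forall>x. clinear_between (fiber V x) (fiber W x) (f x)) \<and>
    (\<forall>U s. open U \<and> smooth_section A V U s \<longrightarrow> smooth_section A W U (\<lambda>x. f x (s x)))"

definition holomorphic_morphism ::
  "('x::t2_space, 'n::finite) chart set \<Rightarrow> ('x, 'v::complex_vector) vbundle \<Rightarrow>
    ('x, 'w::complex_vector) vbundle \<Rightarrow> ('x \<Rightarrow> 'v \<Rightarrow> 'w) \<Rightarrow> bool"
  where "holomorphic_morphism A V W f \<longleftrightarrow>
    (\<forall>x. clinear_between (fiber V x) (fiber W x) (f x)) \<and>
    (\<forall>U s. open U \<and> holomorphic_section A V U s \<longrightarrow> holomorphic_section A W U (\<lambda>x. f x (s x)))"

definition short_exact_sequence ::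
  "('x::t2_space, 'n::finite) chart set \<Rightarrow> ('x, 's::complex_vector) vbundle \<Rightarrow>
    ('x, 'e::complex_vector) vbundle \<Rightarrow> ('x, 'q::complex_vector) vbundle \<Rightarrow>
    ('x \<Rightarrow> 's \<Rightarrow> 'e) \<Rightarrow> ('x \<Rightarrow> 'e \<Rightarrow> 'q) \<Rightarrow> bool"
  where "short_exact_sequence A S E Q j q \<longleftrightarrow>
    holomorphic_morphism A S E j \<and> holomorphic_morphism A E Q q \<and>
    (\<forall>x. inj_on (j x) (fiber S x) \<and>
         j x ` fiber S x = {u \<in> fiber E x. q x u = 0} \<and>
         q x ` fiber E x = fiber Q x)"


section \<open>Hermitian forms\<close>

type_synonym ('x, 'v) form = "'x \<Rightarrow> 'v \<Rightarrow> 'v \<Rightarrow> complex"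

text \<open>\<open>b x u v\<close> stands for \<open>b(u, v\<close>-bar\<open>)\<close>: linear in \<open>u\<close>, conjugate linear in \<open>v\<close>. No positivity or
  nondegeneracy is required; conjugate linearity in \<open>v\<close> follows from Hermitian symmetry.\<close>

definition smooth_hermitian_form ::
  "('x::t2_space, 'n::finite) chart set \<Rightarrow> ('x, 'v::complex_vector) vbundle \<Rightarrow>
    ('x, 'v) form \<Rightarrow> bool"
  where "smooth_hermitian_form A E b \<longleftrightarrow>
    (\<forall>x. \<forall>u\<in>fiber E x. \<forall>v\<in>fiber E x. \<forall>w\<in>fiber E x. b x (u + v) w = b x u w + b x v w) \<and>
    (\<forall>x c. \<forall>u\<in>fiber E x. \<forall>w\<in>fiber E x. b x (c *\<^sub>C u) w = c * b x u w) \<and>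
    (\<forall>x. \<forall>u\<in>fiber E x. \<forall>w\<in>fiber E x. b x w u = cnj (b x u w)) \<and>
    (\<forall>U s t. open U \<and> smooth_section A E U s \<and> smooth_section A E U t \<longrightarrow>
      smooth_fun A U (\<lambda>x. b x (s x) (t x)))"

definition form_kernel ::
  "('x, 'v::complex_vector) vbundle \<Rightarrow> ('x, 'v) form \<Rightarrow> 'x \<Rightarrow> 'v set"
  where "form_kernel E b x = {u \<in> fiber E x. \<forall>v\<in>fiber E x. b x u v = 0}"

definition pullback_form :: "('x \<Rightarrow> 's \<Rightarrow> 'e) \<Rightarrow> ('x, 'e) form \<Rightarrow> ('x, 's) form"
  where "pullback_form j b x u v = b x (j x u) (j x v)"

definition sub_perp ::
  "('x, 's::complex_vector) vbundle \<Rightarrow> ('x, 'e::complex_vector) vbundle \<Rightarrow>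
    ('x \<Rightarrow> 's \<Rightarrow> 'e) \<Rightarrow> ('x, 'e) form \<Rightarrow> 'x \<Rightarrow> 'e set"
  where "sub_perp S E j b x = {v \<in> fiber E x. \<forall>w \<in> j x ` fiber S x. b x v w = 0}"

text \<open>The form on the quotient is the common value of \<open>b\<close> on all lifts to \<open>sub_perp\<close>.\<close>

definition quotient_form ::
  "('x, 's::complex_vector) vbundle \<Rightarrow> ('x, 'e::complex_vector) vbundle \<Rightarrow>
    ('x \<Rightarrow> 's \<Rightarrow> 'e) \<Rightarrow> ('x \<Rightarrow> 'e \<Rightarrow> 'q::complex_vector) \<Rightarrow> ('x, 'e) form \<Rightarrow> ('x, 'q) form"
  where "quotient_form S E j q b x u v =
    (THE c. \<forall>u' \<in> sub_perp S E j b x. \<forall>v' \<in> sub_perp S E j b x.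
      q x u' = u \<and> q x v' = v \<longrightarrow> c = b x u' v')"

text \<open>\<open>fd\<close> is an adjoint of \<open>f: (V, bV) \<rightarrow> (W, bW)\<close>.\<close>

definition is_adjoint ::
  "('x::t2_space, 'n::finite) chart set \<Rightarrow> ('x, 'v::complex_vector) vbundle \<Rightarrow> ('x, 'v) form \<Rightarrow>
    ('x, 'w::complex_vector) vbundle \<Rightarrow> ('x, 'w) form \<Rightarrow>
    ('x \<Rightarrow> 'v \<Rightarrow> 'w) \<Rightarrow> ('x \<Rightarrow> 'w \<Rightarrow> 'v) \<Rightarrow> bool"
  where "is_adjoint A V bV W bW f fd \<longleftrightarrow>
    smooth_morphism A W V fd \<and>
    (\<forall>x. \<forall>u\<in>fiber W x. \<forall>y\<in>fiber V x. bV x (fd x u) y = bW x u (f x y))"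


section \<open>Connections and curvature\<close>

text \<open>A bundle-valued 1-form \<open>\<omega>\<close> takes a point and a complex tangent vector there.\<close>

type_synonym ('x, 'v) vform1 = "'x \<Rightarrow> 'x tvec \<Rightarrow> 'v"

text \<open>\<open>D s x v\<close> is the derivative of \<open>s\<close> at \<open>x\<close> in the direction \<open>v\<close>. A connection acts on smooth
  sections over arbitrary open sets \<open>U\<close>, compatibly with restriction: sections are total functions
  whose values off \<open>U\<close> are irrelevant, which is what the last clause says.\<close>

definition is_connection ::
  "('x::t2_space, 'n::finite) chart set \<Rightarrow> ('x, 'v::complex_vector) vbundle \<Rightarrow>
    (('x \<Rightarrow> 'v) \<Rightarrow> ('x, 'v) vform1) \<Rightarrow> bool"
  where "is_connection A E D \<longleftrightarrow>
    (\<forall>U s. open U \<and> smooth_section A E U s \<longrightarrow>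
      (\<forall>x\<in>U. \<forall>v\<in>tangent A x. D s x v \<in> fiber E x) \<and>
      (\<forall>x\<in>U. \<forall>v\<in>tangent A x. \<forall>w\<in>tangent A x. D s x (\<lambda>f. v f + w f) = D s x v + D s x w) \<and>
      (\<forall>x\<in>U. \<forall>v\<in>tangent A x. \<forall>c. D s x (\<lambda>f. c * v f) = c *\<^sub>C D s x v) \<and>
      (\<forall>\<xi>. smooth_field A U \<xi> \<longrightarrow> smooth_section A E U (\<lambda>x. D s x (\<xi> x)))) \<and>
    (\<forall>U s t. open U \<and> smooth_section A E U s \<and> smooth_section A E U t \<longrightarrow>
      (\<forall>x\<in>U. \<forall>v\<in>tangent A x. D (\<lambda>y. s y + t y) x v = D s x v + D t x v)) \<and>
    (\<forall>U f s. open U \<and> smooth_fun A U f \<and> smooth_section A E U s \<longrightarrow>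
      (\<forall>x\<in>U. \<forall>v\<in>tangent A x. D (\<lambda>y. f y *\<^sub>C s y) x v = v f *\<^sub>C s x + f x *\<^sub>C D s x v)) \<and>
    (\<forall>U s t. open U \<and> smooth_section A E U s \<and> smooth_section A E U t \<and> (\<forall>x\<in>U. s x = t x) \<longrightarrow>
      (\<forall>x\<in>U. \<forall>v\<in>tangent A x. D s x v = D t x v))"

text \<open>The operator \<open>\<partial>\<close>-bar in a holomorphic frame \<open>e\<close> differentiates the coefficients along
  \<open>(0,1)\<close>-vectors.\<close>

definition dbar_in_frame ::
  "nat \<Rightarrow> (nat \<Rightarrow> 'x \<Rightarrow> 'v::complex_vector) \<Rightarrow> ('x \<Rightarrow> 'v) \<Rightarrow> ('x, 'v) vform1"
  where "dbar_in_frame r e s x v = (\<Sum>i<r. v (\<lambda>y. frame_coord r e y (s y) i) *\<^sub>C e i x)"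

definition chern_connection ::
  "('x::t2_space, 'n::finite) chart set \<Rightarrow> ('x, 'v::complex_vector) vbundle \<Rightarrow> ('x, 'v) form \<Rightarrow>
    (('x \<Rightarrow> 'v) \<Rightarrow> ('x, 'v) vform1) \<Rightarrow> bool"
  where "chern_connection A E b D \<longleftrightarrow>
    is_connection A E D \<and>
    (\<forall>U s t. open U \<and> smooth_section A E U s \<and> smooth_section A E U t \<longrightarrow>
      (\<forall>x\<in>U. \<forall>v\<in>tangent A x.
        v (\<lambda>y. b y (s y) (t y)) = b x (D s x v) (t x) + b x (s x) (D t x (conj_tvec v)))) \<and>
    (\<forall>U s. open U \<and> smooth_section A E U s \<longrightarrow>
      (\<forall>(V, r, e)\<in>frames E. \<forall>x\<in>U \<inter> V. \<forall>v\<in>tangent01 A x. D s x v = dbar_in_frame r e s x v))"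

text \<open>The extension of \<open>D\<close> to bundle-valued 1-forms, evaluated on vector fields. The wedge product is
  normalised by \<open>(\<theta> \<and> \<tau>)(\<xi>, \<eta>) = \<theta>(\<xi>) \<tau>(\<eta>) - \<theta>(\<eta>) \<tau>(\<xi>)\<close>, so that \<open>dz\<^sub>j \<and> dz\<^sub>k\<close>-bar takes the value
  \<open>\<alpha>\<^sub>j\<close> times the conjugate of \<open>\<beta>\<^sub>k\<close> on \<open>(\<alpha>, \<beta>\<close>-bar\<open>)\<close>, and \<open>D (\<theta> \<otimes> s) = d\<theta> \<otimes> s - \<theta> \<and> D s\<close>.\<close>

definition ext_cov_deriv ::
  "('x::t2_space, 'n::finite) chart set \<Rightarrow> (('x \<Rightarrow> 'v::complex_vector) \<Rightarrow> ('x, 'v) vform1) \<Rightarrow>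
    ('x, 'v) vform1 \<Rightarrow> ('x \<Rightarrow> 'x tvec) \<Rightarrow> ('x \<Rightarrow> 'x tvec) \<Rightarrow> 'x \<Rightarrow> 'v"
  where "ext_cov_deriv A D \<omega> \<xi> \<eta> x =
    D (\<lambda>y. \<omega> y (\<eta> y)) x (\<xi> x) - D (\<lambda>y. \<omega> y (\<xi> y)) x (\<eta> x) - \<omega> x (lie_bracket A \<xi> \<eta> x)"

text \<open>\<open>R(\<alpha>, \<beta>\<close>-bar\<open>, s, t\<close>-bar\<open>)\<close>, for fields \<open>\<alpha>\<close>, \<open>\<beta>\<close> of type \<open>(1,0)\<close>.\<close>

definition curvature_tensor ::
  "('x::t2_space, 'n::finite) chart set \<Rightarrow> ('x, 'v::complex_vector) form \<Rightarrow>
    (('x \<Rightarrow> 'v) \<Rightarrow> ('x, 'v) vform1) \<Rightarrow> ('x \<Rightarrow> 'x tvec) \<Rightarrow> ('x \<Rightarrow> 'x tvec) \<Rightarrow>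
    ('x \<Rightarrow> 'v) \<Rightarrow> ('x \<Rightarrow> 'v) \<Rightarrow> 'x \<Rightarrow> complex"
  where "curvature_tensor A b D \<alpha> \<beta> s t x =
    b x (ext_cov_deriv A D (D s) \<alpha> (\<lambda>y. conj_tvec (\<beta> y)) x) (t x)"


section \<open>The second fundamental form\<close>

type_synonym ('x, 'v, 'w) hom_form1 = "'x \<Rightarrow> 'x tvec \<Rightarrow> 'v \<Rightarrow> 'w"

text \<open>The value on a fiber element \<open>u\<close> is the common value of \<open>q (D\<^sub>E (j s) - j (D\<^sub>S s))\<close> over all smooth
  local sections \<open>s\<close> with \<open>s x = u\<close>.\<close>

definition second_fundamental_form ::
  "('x::t2_space, 'n::finite) chart set \<Rightarrow> ('x, 's::complex_vector) vbundle \<Rightarrow>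
    ('x \<Rightarrow> 's \<Rightarrow> 'e::complex_vector) \<Rightarrow> ('x \<Rightarrow> 'e \<Rightarrow> 'q::complex_vector) \<Rightarrow>
    (('x \<Rightarrow> 's) \<Rightarrow> ('x, 's) vform1) \<Rightarrow> (('x \<Rightarrow> 'e) \<Rightarrow> ('x, 'e) vform1) \<Rightarrow>
    ('x, 's, 'q) hom_form1"
  where "second_fundamental_form A S j q DS DE x v u =
    (THE w. \<forall>U s. open U \<and> x \<in> U \<and> smooth_section A S U s \<and> s x = u \<longrightarrow>
      w = q x (DE (\<lambda>y. j y (s y)) x v - j x (DS s x v)))"

definition smooth_hom_form01 ::
  "('x::t2_space, 'n::finite) chart set \<Rightarrow> ('x, 'v::complex_vector) vbundle \<Rightarrow>
    ('x, 'w::complex_vector) vbundle \<Rightarrow> ('x, 'v, 'w) hom_form1 \<Rightarrow> bool"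
  where "smooth_hom_form01 A V W \<omega> \<longleftrightarrow>
    (\<forall>x. \<forall>v\<in>tangent A x. clinear_between (fiber V x) (fiber W x) (\<omega> x v)) \<and>
    (\<forall>x. \<forall>v\<in>tangent A x. \<forall>w\<in>tangent A x. \<forall>u\<in>fiber V x.
      \<omega> x (\<lambda>f. v f + w f) u = \<omega> x v u + \<omega> x w u) \<and>
    (\<forall>x c. \<forall>v\<in>tangent A x. \<forall>u\<in>fiber V x. \<omega> x (\<lambda>f. c * v f) u = c *\<^sub>C \<omega> x v u) \<and>
    (\<forall>x. \<forall>v\<in>tangent10 A x. \<forall>u\<in>fiber V x. \<omega> x v u = 0) \<and>
    (\<forall>U \<xi> s. open U \<and> smooth_field A U \<xi> \<and> smooth_section A V U s \<longrightarrow>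
      smooth_section A W U (\<lambda>x. \<omega> x (\<xi> x) (s x)))"

text \<open>\<open>\<omega>d\<close> is an adjoint of the \<open>(1,0)\<close>-form \<open>\<omega>\<close> with values in \<open>Hom(V, W)\<close>.\<close>

definition is_adjoint_form10 ::
  "('x::t2_space, 'n::finite) chart set \<Rightarrow> ('x, 'v::complex_vector) vbundle \<Rightarrow> ('x, 'v) form \<Rightarrow>
    ('x, 'w::complex_vector) vbundle \<Rightarrow> ('x, 'w) form \<Rightarrow>
    ('x, 'v, 'w) hom_form1 \<Rightarrow> ('x, 'w, 'v) hom_form1 \<Rightarrow> bool"
  where "is_adjoint_form10 A V bV W bW \<omega> \<omega>d \<longleftrightarrow>
    smooth_hom_form01 A W V \<omega>d \<and>
    (\<forall>x. \<forall>v\<in>tangent10 A x. \<forall>u\<in>fiber W x. \<forall>y\<in>fiber V x.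
      bV x (\<omega>d x (conj_tvec v) u) y = bW x u (\<omega> x v y))"

end

theory Submission
  imports Defs
begin

text \<open>
  Metric compatibility turns a curvature tensor into
  \<open>R(\<alpha>, \<beta>\<close>-bar\<open>, s, t) = \<alpha> b(D\<^sub>\<gamma> s, t) - \<gamma> b(D\<^sub>\<alpha> s, t) - b(D\<^bsub>[\<alpha>, \<gamma>]\<^esub> s, t) +
  b(D\<^sub>\<alpha> s, D\<^sub>\<beta> t) - b(D\<^sub>\<gamma> s, D\<^sub>\<delta> t)\<close>, where \<open>\<gamma>\<close> and \<open>\<delta>\<close> are the conjugates of \<open>\<beta>\<close> and \<open>\<alpha>\<close>
  (lemma \<open>curvature_tensor_metric\<close>). Suppose that sections of two bundles give the same functions
  \<open>b(D\<^sub>\<xi> s, t)\<close> for every direction \<open>\<xi>\<close>. Then their curvatures differ only in the last two terms,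
  which contain no second derivatives (lemma \<open>curvature_tensor_difference\<close>). Both formulas are of
  this kind.

  For \<open>S\<close>, compare \<open>s, t\<close> with \<open>j s, j t\<close>. As \<open>j\<close> is holomorphic, \<open>D\<^sub>E (j s)\<close> and \<open>j (D\<^sub>S s)\<close> agree
  in direction \<open>(0,1)\<close>. In direction \<open>(1,0)\<close> their difference lies in \<open>S\<^sup>\<bottom>\<close>, by compatibility
  with the forms, and \<open>q\<close> maps it to \<open>\<sigma>(s)\<close>. So only the term \<open>b(D\<^sub>\<alpha> s, D\<^sub>\<beta> t)\<close> changes, by
  \<open>b\<^sub>Q(\<sigma>(\<alpha>, s), \<sigma>(\<beta>, t))\<close>.

  For \<open>Q\<close>, compare \<open>s, t\<close> with \<open>q\<^sup>\<dagger> s, q\<^sup>\<dagger> t\<close>. The adjoint takes values in \<open>S\<^sup>\<bottom>\<close> and inverts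
  \<open>q\<close> modulo the kernel of \<open>b\<^sub>Q\<close>. Modulo the kernel of \<open>b\<^sub>E\<close>, \<open>D\<^sub>E (q\<^sup>\<dagger> s)\<close> is \<open>q\<^sup>\<dagger> (D\<^sub>Q s)\<close>
  in direction \<open>(1,0)\<close> and \<open>q\<^sup>\<dagger> (D\<^sub>Q s) - j (\<sigma>\<^sup>\<dagger> s)\<close> in direction \<open>(0,1)\<close> (lemma
  \<open>D_qd_mod_kernel\<close>); the last term comes from differentiating \<open>b\<^sub>E(q\<^sup>\<dagger> s, j t) = 0\<close>. So only the
  term \<open>b(D\<^sub>\<gamma> s, D\<^sub>\<delta> t)\<close> changes. All statements about \<open>Q\<close> are made under the form, because in the
  degenerate case neither \<open>q\<^sup>\<dagger>\<close> nor \<open>D\<^sub>Q\<close> is determined by it.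

  The comparison in the direction \<open>[\<alpha>, \<gamma>]\<close> requires the bracket of two vector fields to be a tangent
  vector, hence the symmetry of second derivatives. Tensoriality of \<open>\<sigma>\<close> and the statements about
  direction \<open>(0,1)\<close> come from expanding sections in holomorphic frames.
\<close>

section \<open>Functions of class \<open>C\<close>-infinity\<close>

lemma C_diff_subset: "C_diff k U f \<Longrightarrow> V \<subseteq> U \<Longrightarrow> C_diff k V f"
proof (induction k arbitrary: f)
  case 0
  then show ?case by (auto intro: continuous_on_subset)
next
  case (Suc k)
  then show ?case by (auto simp: subset_iff)
qed

lemma C_diff_cong:
  assumes "open U" "\<And>x. x \<in> U \<Longrightarrow> f x = g x" "C_diff k U f"
  shows "C_diff k U g"
  using assms(2,3)
proof (induction k arbitrary: f g)
  case 0
  then show ?case by (simp cong: continuous_on_cong)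
next
  case (Suc k)
  have d: "f differentiable (at x)" if "x \<in> U" for x
    using Suc.prems(2) that by simp
  have eq: "frechet_derivative f (at x) = frechet_derivative g (at x)" if "x \<in> U" for x
    using frechet_derivative_transform_within_open[OF d[OF that] assms(1) that Suc.prems(1)] .
  have "g differentiable (at x)" if "x \<in> U" for x
    using d[OF that] Suc.prems(1) assms(1) that
    by (metis differentiable_def has_derivative_transform_within_open)
  moreover have "C_diff k U (\<lambda>x. frechet_derivative g (at x) v)" for v
    by (rule Suc.IH[of "\<lambda>x. frechet_derivative f (at x) v"]) (use eq Suc.prems(2) in auto)
  ultimately show ?case by simp
qed

lemma C_diff_local:
  assumes "\<And>x. x \<in> U \<Longrightarrow> \<exists>V. open V \<and> x \<in> V \<and> C_diff k V f"
  shows "C_diff k U f"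
  using assms
proof (induction k arbitrary: f)
  case 0
  then have "continuous (at x) f" if "x \<in> U" for x
    using that by (metis C_diff.simps(1) continuous_on_eq_continuous_at)
  then show ?case by (simp add: continuous_at_imp_continuous_on)
next
  case (Suc k)
  have "f differentiable (at x)" if "x \<in> U" for x
    using Suc.prems[OF that] by auto
  moreover have "C_diff k U (\<lambda>x. frechet_derivative f (at x) v)" for v
    by (rule Suc.IH) (use Suc.prems in fastforce)
  ultimately show ?case by simp
qed

lemma C_diff_decrease: "C_diff (Suc k) U f \<Longrightarrow> C_diff k U f"
proof (induction k arbitrary: f)
  case 0
  then show ?case
    by (auto intro!: continuous_at_imp_continuous_on differentiable_imp_continuous_within)
next
  case (Suc k)
  then show ?case by (metis C_diff.simps(2))
qed

lemma C_diff_const: "C_diff k U (\<lambda>x. c)"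
  by (induction k arbitrary: c) auto

lemma C_diff_add:
  assumes "open U" "C_diff k U f" "C_diff k U g"
  shows "C_diff k U (\<lambda>x. f x + g x)"
  using assms(2,3)
proof (induction k arbitrary: f g)
  case 0
  then show ?case by (auto intro: continuous_on_add)
next
  case (Suc k)
  have d: "f differentiable (at x)" "g differentiable (at x)" if "x \<in> U" for x
    using Suc.prems that by auto
  have eq: "frechet_derivative f (at x) v + frechet_derivative g (at x) v
      = frechet_derivative (\<lambda>x. f x + g x) (at x) v" if "x \<in> U" for x v
    using frechet_derivative_at[OF has_derivative_add[OF
          d(1)[OF that, unfolded frechet_derivative_works]
          d(2)[OF that, unfolded frechet_derivative_works]]]
    by metis
  have "C_diff k U (\<lambda>x. frechet_derivative (\<lambda>x. f x + g x) (at x) v)" for v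
    using Suc by (intro C_diff_cong[OF assms(1) eq[of _ v]] Suc.IH) auto
  then show ?case using d by auto
qed

lemma C_diff_mult:
  fixes f g :: "'a::real_normed_vector \<Rightarrow> complex"
  assumes "open U" "C_diff k U f" "C_diff k U g"
  shows "C_diff k U (\<lambda>x. f x * g x)"
  using assms(2,3)
proof (induction k arbitrary: f g)
  case 0
  then show ?case by (auto intro: continuous_on_mult)
next
  case (Suc k)
  have d: "f differentiable (at x)" "g differentiable (at x)" if "x \<in> U" for x
    using Suc.prems that by auto
  have eq: "f x * frechet_derivative g (at x) v + frechet_derivative f (at x) v * g x
      = frechet_derivative (\<lambda>x. f x * g x) (at x) v" if "x \<in> U" for x v
    using frechet_derivative_at[OF has_derivative_mult[OF
          d(1)[OF that, unfolded frechet_derivative_works]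
          d(2)[OF that, unfolded frechet_derivative_works]]]
    by metis
  have "C_diff k U (\<lambda>x. frechet_derivative (\<lambda>x. f x * g x) (at x) v)" for v
  proof (rule C_diff_cong[OF assms(1) eq[of _ v]])
    show "C_diff k U
        (\<lambda>x. f x * frechet_derivative g (at x) v + frechet_derivative f (at x) v * g x)"
      using Suc.prems C_diff_decrease[OF Suc.prems(1)] C_diff_decrease[OF Suc.prems(2)]
      by (intro C_diff_add[OF assms(1)] Suc.IH) auto
  qed auto
  moreover have "(\<lambda>x. f x * g x) differentiable (at x)" if "x \<in> U" for x
    using d[OF that] by (rule differentiable_mult)
  ultimately show ?case by simp
qed

lemma frechet_derivative_bounded_linear:
  assumes "bounded_linear L" "f differentiable (at x)"
  shows "frechet_derivative (\<lambda>x. L (f x)) (at x) v = L (frechet_derivative f (at x) v)"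
  using frechet_derivative_at[OF bounded_linear.has_derivative[OF assms(1)
        assms(2)[unfolded frechet_derivative_works]]]
  by metis

lemma C_diff_bounded_linear:
  assumes "bounded_linear L" "open U" "C_diff k U f"
  shows "C_diff k U (\<lambda>x. L (f x))"
  using assms(3)
proof (induction k arbitrary: f)
  case 0
  then show ?case using bounded_linear.continuous_on[OF assms(1)] by auto
next
  case (Suc k)
  have d: "f differentiable (at x)" if "x \<in> U" for x
    using Suc.prems that by auto
  have eq: "L (frechet_derivative f (at x) v) = frechet_derivative (\<lambda>x. L (f x)) (at x) v"
    if "x \<in> U" for x v
    using frechet_derivative_bounded_linear[OF assms(1) d[OF that]] by simp
  have "C_diff k U (\<lambda>x. frechet_derivative (\<lambda>x. L (f x)) (at x) v)" for v
    using Suc by (intro C_diff_cong[OF assms(2) eq[of _ v]] Suc.IH) auto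
  moreover have "(\<lambda>x. L (f x)) differentiable (at x)" if "x \<in> U" for x
    using bounded_linear.has_derivative[OF assms(1)] d[OF that] unfolding differentiable_def
    by blast
  ultimately show ?case by simp
qed

lemma C_infinity_subset: "C_infinity U f \<Longrightarrow> V \<subseteq> U \<Longrightarrow> C_infinity V f"
  unfolding C_infinity_def using C_diff_subset by blast

lemma C_infinity_cong:
  "C_infinity U f \<Longrightarrow> open U \<Longrightarrow> (\<And>x. x \<in> U \<Longrightarrow> f x = g x) \<Longrightarrow> C_infinity U g"
  unfolding C_infinity_def using C_diff_cong by blast

lemma C_infinity_local:
  "(\<And>x. x \<in> U \<Longrightarrow> \<exists>V. open V \<and> x \<in> V \<and> C_infinity V f) \<Longrightarrow> C_infinity U f"
  unfolding C_infinity_def by (meson C_diff_local)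

lemma C_infinity_const: "C_infinity U (\<lambda>x. c)"
  unfolding C_infinity_def by (simp add: C_diff_const)

lemma C_infinity_add:
  "open U \<Longrightarrow> C_infinity U f \<Longrightarrow> C_infinity U g \<Longrightarrow> C_infinity U (\<lambda>x. f x + g x)"
  unfolding C_infinity_def using C_diff_add by blast

lemma C_infinity_mult:
  fixes f g :: "'a::real_normed_vector \<Rightarrow> complex"
  shows "open U \<Longrightarrow> C_infinity U f \<Longrightarrow> C_infinity U g \<Longrightarrow> C_infinity U (\<lambda>x. f x * g x)"
  unfolding C_infinity_def using C_diff_mult by blast

lemma C_infinity_bounded_linear:
  "bounded_linear L \<Longrightarrow> open U \<Longrightarrow> C_infinity U f \<Longrightarrow> C_infinity U (\<lambda>x. L (f x))"
  unfolding C_infinity_def using C_diff_bounded_linear by blast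

lemma C_infinity_differentiable: "C_infinity U f \<Longrightarrow> x \<in> U \<Longrightarrow> f differentiable (at x)"
  unfolding C_infinity_def by (metis C_diff.simps(2))

lemma C_infinity_frechet_derivative:
  "C_infinity U f \<Longrightarrow> C_infinity U (\<lambda>x. frechet_derivative f (at x) v)"
  unfolding C_infinity_def by (metis C_diff.simps(2))

lemma C_infinity_continuous: "C_infinity U f \<Longrightarrow> continuous_on U f"
  unfolding C_infinity_def by (metis C_diff.simps(1))


section \<open>Symmetry of the second derivative\<close>

abbreviation second_derivative ::
  "('a::real_normed_vector \<Rightarrow> 'b::real_normed_vector) \<Rightarrow> 'a \<Rightarrow> 'a \<Rightarrow> 'a \<Rightarrow> 'b"
  where "second_derivative f x u v \<equiv>
    frechet_derivative (\<lambda>y. frechet_derivative f (at y) v) (at x) u"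

lemma has_field_derivative_along_line:
  fixes f :: "'a::real_normed_vector \<Rightarrow> real"
  assumes "f differentiable (at (p + s *\<^sub>R u))"
  shows "((\<lambda>s. f (p + s *\<^sub>R u)) has_real_derivative frechet_derivative f (at (p + s *\<^sub>R u)) u)
    (at s)"
proof -
  let ?D = "frechet_derivative f (at (p + s *\<^sub>R u))"
  have D: "(f has_derivative ?D) (at (p + s *\<^sub>R u))"
    using assms frechet_derivative_works by blast
  have "((\<lambda>s. f (p + s *\<^sub>R u)) has_derivative (\<lambda>h. ?D (h *\<^sub>R u))) (at s)"
    by (rule has_derivative_compose[where g = f and f = "\<lambda>s. p + s *\<^sub>R u", OF _ D])
      (auto intro!: derivative_eq_intros)
  moreover have "(\<lambda>h. ?D (h *\<^sub>R u)) = (*) (?D u)"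
    by (simp add: linear_scale[OF has_derivative_linear[OF D]] mult.commute fun_eq_iff)
  ultimately show ?thesis by (simp add: has_field_derivative_def)
qed

text \<open>Two applications of the mean value theorem: the mixed second difference of \<open>f\<close> over a small
  parallelogram is a value of the second derivative. The second difference does not change when \<open>u\<close>
  and \<open>v\<close> are exchanged, which forces the symmetry of the second derivative below.\<close>

lemma second_difference_eq_second_derivative:
  fixes f :: "'a::real_normed_vector \<Rightarrow> real"
  assumes f: "C_infinity U f" and h: "0 < h"
    and U: "\<And>s t. 0 \<le> s \<Longrightarrow> s \<le> h \<Longrightarrow> 0 \<le> t \<Longrightarrow> t \<le> h \<Longrightarrow> p + s *\<^sub>R u + t *\<^sub>R v \<in> U"
  obtains s t where "0 < s" "s < h" "0 < t" "t < h"
    "f (p + h *\<^sub>R u + h *\<^sub>R v) - f (p + h *\<^sub>R u) - f (p + h *\<^sub>R v) + f p =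
      h * (h * second_derivative f (p + s *\<^sub>R u + t *\<^sub>R v) v u)"
proof -
  define g where "g y = frechet_derivative f (at y) u" for y
  have line: "p + h *\<^sub>R v + s *\<^sub>R u \<in> U" "p + s *\<^sub>R u \<in> U" if "0 \<le> s" "s \<le> h" for s
    using U[of s h] U[of s 0] that h by (auto simp: algebra_simps)
  have "\<exists>s. 0 < s \<and> s < h \<and>
      (f (p + h *\<^sub>R v + h *\<^sub>R u) - f (p + h *\<^sub>R u)) - (f (p + h *\<^sub>R v + 0 *\<^sub>R u) - f (p + 0 *\<^sub>R u))
      = (h - 0) * (g (p + h *\<^sub>R v + s *\<^sub>R u) - g (p + s *\<^sub>R u))"
    unfolding g_def
    by (rule MVT2[OF h]) (intro DERIV_diff has_field_derivative_along_line
        C_infinity_differentiable[OF f] line; simp)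
  then obtain s where s: "0 < s" "s < h"
    "(f (p + h *\<^sub>R v + h *\<^sub>R u) - f (p + h *\<^sub>R u)) - (f (p + h *\<^sub>R v) - f p)
      = h * (g (p + h *\<^sub>R v + s *\<^sub>R u) - g (p + s *\<^sub>R u))" by auto
  have "\<exists>t. 0 < t \<and> t < h \<and> g (p + s *\<^sub>R u + h *\<^sub>R v) - g (p + s *\<^sub>R u + 0 *\<^sub>R v)
      = (h - 0) * frechet_derivative g (at (p + s *\<^sub>R u + t *\<^sub>R v)) v"
  proof (rule MVT2[OF h], rule has_field_derivative_along_line)
    fix t :: real assume "0 \<le> t" "t \<le> h"
    then show "g differentiable (at (p + s *\<^sub>R u + t *\<^sub>R v))"
      using C_infinity_differentiable[OF C_infinity_frechet_derivative[OF f]] U s(1,2)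
      unfolding g_def by auto
  qed
  then obtain t where t: "0 < t" "t < h"
    "g (p + s *\<^sub>R u + h *\<^sub>R v) - g (p + s *\<^sub>R u)
      = h * frechet_derivative g (at (p + s *\<^sub>R u + t *\<^sub>R v)) v" by auto
  show ?thesis
  proof (rule that[OF s(1,2) t(1,2)])
    have eq: "p + h *\<^sub>R u + h *\<^sub>R v = p + h *\<^sub>R v + h *\<^sub>R u"
      "p + s *\<^sub>R u + h *\<^sub>R v = p + h *\<^sub>R v + s *\<^sub>R u" by (simp_all add: algebra_simps)
    have "f (p + h *\<^sub>R u + h *\<^sub>R v) - f (p + h *\<^sub>R u) - f (p + h *\<^sub>R v) + f p
        = (f (p + h *\<^sub>R v + h *\<^sub>R u) - f (p + h *\<^sub>R u)) - (f (p + h *\<^sub>R v) - f p)"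
      unfolding eq by simp
    also have "\<dots> = h * (h * frechet_derivative g (at (p + s *\<^sub>R u + t *\<^sub>R v)) v)"
      unfolding s(3) t(3)[symmetric] eq ..
    finally show "f (p + h *\<^sub>R u + h *\<^sub>R v) - f (p + h *\<^sub>R u) - f (p + h *\<^sub>R v) + f p =
      h * (h * second_derivative f (p + s *\<^sub>R u + t *\<^sub>R v) v u)"
      unfolding g_def .
  qed
qed

lemma second_derivative_symmetric_real:
  fixes f :: "'a::real_normed_vector \<Rightarrow> real"
  assumes f: "C_infinity U f" and U: "open U" "p \<in> U"
  shows "second_derivative f p u v = second_derivative f p v u"
proof (rule ccontr)
  define G where "G y = second_derivative f y v u - second_derivative f y u v" for y
  assume "second_derivative f p u v \<noteq> second_derivative f p v u"
  define e where "e = \<bar>second_derivative f p v u - second_derivative f p u v\<bar> / 2"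
  then have e: "0 < e" using \<open>_ \<noteq> _\<close> by simp
  have cont: "isCont (\<lambda>y. second_derivative f y a b) p" for a b
    using C_infinity_continuous[OF C_infinity_frechet_derivative[OF
          C_infinity_frechet_derivative[OF f]]] U
    by (simp add: continuous_on_eq_continuous_at)
  have "\<exists>d>0. \<forall>y. dist y p < d \<longrightarrow> dist (second_derivative f y a b) (second_derivative f p a b) < e"
    for a b
    using cont e unfolding continuous_at_eps_delta by auto
  then obtain d where d: "\<And>a b. 0 < d a b"
    "\<And>a b y. dist y p < d a b \<Longrightarrow>
      dist (second_derivative f y a b) (second_derivative f p a b) < e"
    by metis
  obtain d0 where d0: "0 < d0" "\<And>y. dist y p < d0 \<Longrightarrow> y \<in> U"
    using U unfolding open_dist by metis
  define m where "m = min d0 (min (d u v) (d v u))"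
  have m: "0 < m" using d d0 by (simp add: m_def)
  define N where "N = norm u + norm v + 1"
  \<comment> \<open>With this \<open>h\<close> the parallelogram spanned by \<open>h u\<close> and \<open>h v\<close> lies in the ball of radius \<open>m\<close>.\<close>
  define h where "h = m / (2 * N)"
  have N: "0 < N" unfolding N_def by (smt (verit) norm_ge_zero)
  have h: "0 < h" using m N by (simp add: h_def)
  have near: "dist (p + s *\<^sub>R a + t *\<^sub>R b) p < m"
    if "0 \<le> s" "s \<le> h" "0 \<le> t" "t \<le> h" "norm a + norm b + 1 = N" for s t a b
  proof -
    have "dist (p + s *\<^sub>R a + t *\<^sub>R b) p \<le> s * norm a + t * norm b"
      using that norm_triangle_ineq[of "s *\<^sub>R a" "t *\<^sub>R b"] by (simp add: dist_norm algebra_simps)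
    also have "\<dots> \<le> h * norm a + h * norm b"
      using that by (intro add_mono mult_right_mono) auto
    also have "\<dots> \<le> h * N" using h that(5) by (simp flip: distrib_left)
    also have "\<dots> < m" using m N by (simp add: h_def)
    finally show ?thesis .
  qed
  have uv: "norm u + norm v + 1 = N" "norm v + norm u + 1 = N" by (simp_all add: N_def)
  obtain s t where st: "0 < s" "s < h" "0 < t" "t < h"
    "f (p + h *\<^sub>R u + h *\<^sub>R v) - f (p + h *\<^sub>R u) - f (p + h *\<^sub>R v) + f p =
      h * (h * second_derivative f (p + s *\<^sub>R u + t *\<^sub>R v) v u)"
    using second_difference_eq_second_derivative[OF f h, of p u v] near[OF _ _ _ _ uv(1)] d0(2)
    unfolding m_def by (metis min_less_iff_conj)
  obtain s' t' where st': "0 < s'" "s' < h" "0 < t'" "t' < h"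
    "f (p + h *\<^sub>R v + h *\<^sub>R u) - f (p + h *\<^sub>R v) - f (p + h *\<^sub>R u) + f p =
      h * (h * second_derivative f (p + s' *\<^sub>R v + t' *\<^sub>R u) u v)"
    using second_difference_eq_second_derivative[OF f h, of p v u] near[OF _ _ _ _ uv(2)] d0(2)
    unfolding m_def by (metis min_less_iff_conj)
  have "p + h *\<^sub>R v + h *\<^sub>R u = p + h *\<^sub>R u + h *\<^sub>R v" by (simp add: algebra_simps)
  with st(5) st'(5) h have "second_derivative f (p + s *\<^sub>R u + t *\<^sub>R v) v u
      = second_derivative f (p + s' *\<^sub>R v + t' *\<^sub>R u) u v"
    by (simp add: algebra_simps)
  moreover have "dist (second_derivative f (p + s *\<^sub>R u + t *\<^sub>R v) v u) (second_derivative f p v u) < e"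
    by (rule d(2)) (use near[of s t u v] uv st(1-4) in \<open>simp add: m_def\<close>)
  moreover have "dist (second_derivative f (p + s' *\<^sub>R v + t' *\<^sub>R u) u v) (second_derivative f p u v) < e"
    by (rule d(2)) (use near[of s' t' v u] uv st'(1-4) in \<open>simp add: m_def\<close>)
  ultimately show False
    unfolding e_def dist_real_def by argo
qed

lemma second_derivative_symmetric:
  fixes f :: "'a::real_normed_vector \<Rightarrow> complex"
  assumes f: "C_infinity U f" and U: "open U" "p \<in> U"
  shows "second_derivative f p u v = second_derivative f p v u"
proof -
  have eq: "second_derivative (\<lambda>y. L (f y)) p a b = L (second_derivative f p a b)"
    if L: "bounded_linear L" for L :: "complex \<Rightarrow> real" and a b
  proof -
    have "L (second_derivative f p a b)
        = frechet_derivative (\<lambda>y. L (frechet_derivative f (at y) b)) (at p) a"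
      using frechet_derivative_bounded_linear[OF L C_infinity_differentiable[OF
            C_infinity_frechet_derivative[OF f] U(2)]] by simp
    also have "\<dots> = second_derivative (\<lambda>y. L (f y)) p a b"
    proof (rule fun_cong[OF frechet_derivative_transform_within_open[OF _ U]])
      show "(\<lambda>y. L (frechet_derivative f (at y) b)) differentiable at p"
        using C_infinity_bounded_linear[OF L U(1) C_infinity_frechet_derivative[OF f]] U(2)
        by (rule C_infinity_differentiable)
      show "L (frechet_derivative f (at y) b) = frechet_derivative (\<lambda>y. L (f y)) (at y) b"
        if "y \<in> U" for y
        using frechet_derivative_bounded_linear[OF L C_infinity_differentiable[OF f that]] by simp
    qed
    finally show ?thesis by simp
  qed
  have "L (second_derivative f p u v) = L (second_derivative f p v u)"
    if L: "bounded_linear L" for L :: "complex \<Rightarrow> real"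
    using second_derivative_symmetric_real[OF C_infinity_bounded_linear[OF L U(1) f] U, of v u]
    unfolding eq[OF L] .
  from this[OF bounded_linear_Re] this[OF bounded_linear_Im] show ?thesis
    by (simp add: complex_eq_iff)
qed

text \<open>Smoothness controls the derivative of \<open>F\<close> in a fixed direction; a direction \<open>u z\<close> that varies
  with the point is expanded in a basis.\<close>

lemma has_derivative_directional_derivative:
  fixes F :: "'a::euclidean_space \<Rightarrow> complex"
  assumes F: "C_infinity Z F" and Z: "open Z" "p \<in> Z" and u: "u differentiable (at p)"
  shows "((\<lambda>z. frechet_derivative F (at z) (u z)) has_derivative
    (\<lambda>h. second_derivative F p h (u p) +
         frechet_derivative F (at p) (frechet_derivative u (at p) h))) (at p)"
proof -
  have expand: "frechet_derivative F (at z) v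
      = (\<Sum>b\<in>Basis. (v \<bullet> b) *\<^sub>R frechet_derivative F (at z) b)" if "z \<in> Z" for z v
    using linear_sum[OF linear_frechet_derivative[OF C_infinity_differentiable[OF F that]],
        of "\<lambda>b. (v \<bullet> b) *\<^sub>R b" Basis]
    by (simp add: euclidean_representation
        linear_scale[OF linear_frechet_derivative[OF C_infinity_differentiable[OF F that]]])
  have dF: "((\<lambda>z. frechet_derivative F (at z) b) has_derivative
      (\<lambda>h. second_derivative F p h b)) (at p)" for b
    using C_infinity_differentiable[OF C_infinity_frechet_derivative[OF F] Z(2)]
    unfolding frechet_derivative_works .
  have deriv: "((\<lambda>z. frechet_derivative F (at z) (u z)) has_derivative
      (\<lambda>h. (\<Sum>b\<in>Basis. (u p \<bullet> b) *\<^sub>R second_derivative F p h b) + frechet_derivative F (at p) (u' h)))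
      (at p)" if u: "(u has_derivative u') (at p)" for u u'
  proof -
    have "((\<lambda>z. \<Sum>b\<in>Basis. (u z \<bullet> b) *\<^sub>R frechet_derivative F (at z) b) has_derivative
      (\<lambda>h. \<Sum>b\<in>Basis. (u p \<bullet> b) *\<^sub>R second_derivative F p h b
        + (u' h \<bullet> b) *\<^sub>R frechet_derivative F (at p) b)) (at p)"
      by (intro has_derivative_sum has_derivative_scaleR has_derivative_inner_left u dF)
    then have "((\<lambda>z. frechet_derivative F (at z) (u z)) has_derivative
      (\<lambda>h. \<Sum>b\<in>Basis. (u p \<bullet> b) *\<^sub>R second_derivative F p h b
        + (u' h \<bullet> b) *\<^sub>R frechet_derivative F (at p) b)) (at p)"
      by (rule has_derivative_transform_within_open[OF _ Z]) (simp add: expand)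
    then show ?thesis unfolding sum.distrib expand[OF Z(2), symmetric] .
  qed
  have "(\<Sum>b\<in>Basis. (v \<bullet> b) *\<^sub>R second_derivative F p h b) = second_derivative F p h v" for h v
    using fun_cong[OF has_derivative_unique[OF deriv[OF has_derivative_const[of v]] dF[of v]], of h]
      linear_0[OF linear_frechet_derivative[OF C_infinity_differentiable[OF F Z(2)]]] by simp
  then show ?thesis
    using deriv[OF u[unfolded frechet_derivative_works]] by simp
qed

lemma differentiable_vec:
  fixes f :: "'a::real_normed_vector \<Rightarrow> complex ^ 'n::finite"
  assumes "\<And>i. (\<lambda>z. f z $ i) differentiable (at p)"
  shows "f differentiable (at p)"
proof -
  have "((\<lambda>z. f z \<bullet> axis i b) has_derivative (\<lambda>h. frechet_derivative (\<lambda>z. f z $ i) (at p) h \<bullet> b)) (at p)"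
    for i b
    unfolding inner_axis using assms[unfolded frechet_derivative_works]
    by (intro has_derivative_inner_left) auto
  then have "\<forall>b\<in>Basis. \<exists>f'. ((\<lambda>z. f z \<bullet> b) has_derivative f') (at p)"
    unfolding Basis_vec_def by blast
  then obtain f' where "\<forall>b\<in>Basis. ((\<lambda>z. f z \<bullet> b) has_derivative f' b) (at p)" by metis
  then have "((\<lambda>z. \<Sum>b\<in>Basis. (f z \<bullet> b) *\<^sub>R b) has_derivative (\<lambda>h. \<Sum>b\<in>Basis. f' b h *\<^sub>R b)) (at p)"
    by (intro has_derivative_sum has_derivative_scaleR_left) auto
  then show ?thesis unfolding euclidean_representation differentiable_def by blast
qed

lemma linear_sum_axis:
  fixes D :: "complex ^ 'n::finite \<Rightarrow> complex"
  assumes "linear D"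
  shows "D u = (\<Sum>i\<in>UNIV. of_real (Re (u $ i)) * D (axis i 1) + of_real (Im (u $ i)) * D (axis i \<i>))"
proof -
  have u: "u = (\<Sum>i\<in>UNIV. Re (u $ i) *\<^sub>R axis i 1 + Im (u $ i) *\<^sub>R axis i \<i>)"
    by (simp add: vec_eq_iff axis_def if_distrib[of "(*\<^sub>R) _"] sum.distrib complex_eq_iff
        cong: if_cong)
  have "D u = (\<Sum>i\<in>UNIV. D (Re (u $ i) *\<^sub>R axis i 1 + Im (u $ i) *\<^sub>R axis i \<i>))"
    by (subst u) (rule linear_sum[OF assms])
  also have "\<dots> = (\<Sum>i\<in>UNIV. Re (u $ i) *\<^sub>R D (axis i 1) + Im (u $ i) *\<^sub>R D (axis i \<i>))"
    by (simp only: linear_add[OF assms] linear_scale[OF assms])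
  finally show ?thesis by (simp only: scaleR_conv_of_real)
qed


section \<open>Smooth functions on a complex manifold\<close>

locale atlas =
  fixes A :: "('x::t2_space, 'n::finite) chart set"
  assumes complex_manifold: "complex_manifold A"
begin

lemma chart_obtain:
  obtains c where "c \<in> A" "x \<in> fst c"
proof -
  have "x \<in> (\<Union>(U, \<phi>)\<in>A. U)" using complex_manifold unfolding complex_manifold_def by simp
  then show ?thesis using that by auto
qed

lemma chart_domain_open: "c \<in> A \<Longrightarrow> open (fst c)"
  using complex_manifold unfolding complex_manifold_def case_prod_beta by blast

lemma transition_holomorphic:
  "c \<in> A \<Longrightarrow> c' \<in> A \<Longrightarrow>
    holomorphic_Cn (snd c ` (fst c \<inter> fst c')) (\<lambda>z. snd c' (inv_into (fst c) (snd c) z) $ i)"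
  using complex_manifold unfolding complex_manifold_def case_prod_beta by blast

lemma chart_homeomorphism:
  assumes "c \<in> A"
  obtains \<psi> where "homeomorphism (fst c) (snd c ` fst c) (snd c) \<psi>" "open (snd c ` fst c)"
proof -
  have "open (snd c ` fst c) \<and> (\<exists>\<psi>. homeomorphism (fst c) (snd c ` fst c) (snd c) \<psi>)"
    using complex_manifold assms unfolding complex_manifold_def case_prod_beta by simp
  then show ?thesis using that by blast
qed

lemma chart_inverse: "c \<in> A \<Longrightarrow> x \<in> fst c \<Longrightarrow> inv_into (fst c) (snd c) (snd c x) = x"
proof -
  assume c: "c \<in> A" and x: "x \<in> fst c"
  obtain \<psi> where "homeomorphism (fst c) (snd c ` fst c) (snd c) \<psi>"
    using chart_homeomorphism[OF c] .
  then have "inj_on (snd c) (fst c)"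
    by (intro inj_on_inverseI[of _ \<psi>]) (auto simp: homeomorphism_def)
  then show ?thesis using x by (rule inv_into_f_f)
qed

lemma chart_image_open:
  assumes "c \<in> A" "open W"
  shows "open (snd c ` (fst c \<inter> W))"
proof -
  obtain \<psi> where \<psi>: "homeomorphism (fst c) (snd c ` fst c) (snd c) \<psi>" "open (snd c ` fst c)"
    using chart_homeomorphism[OF assms(1)] .
  have "openin (top_of_set (snd c ` fst c)) (snd c ` (fst c \<inter> W))"
    using assms(2) by (intro homeomorphism_imp_open_map[OF \<psi>(1)]) (simp add: openin_open_Int)
  then show ?thesis using \<psi>(2) openin_open_trans by blast
qed

lemma smooth_funI:
  "(\<And>c. c \<in> A \<Longrightarrow> C_infinity (snd c ` (fst c \<inter> W)) (\<lambda>z. f (inv_into (fst c) (snd c) z))) \<Longrightarrow>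
    smooth_fun A W f"
  unfolding smooth_fun_def by fastforce

lemma smooth_funD:
  "smooth_fun A W f \<Longrightarrow> c \<in> A \<Longrightarrow>
    C_infinity (snd c ` (fst c \<inter> W)) (\<lambda>z. f (inv_into (fst c) (snd c) z))"
  unfolding smooth_fun_def by (cases c) auto

lemma smooth_fun_subset: "smooth_fun A W f \<Longrightarrow> V \<subseteq> W \<Longrightarrow> smooth_fun A V f"
  by (rule smooth_funI, rule C_infinity_subset[OF smooth_funD]) auto

lemma smooth_fun_cong:
  assumes "smooth_fun A W f" "open W" "\<And>x. x \<in> W \<Longrightarrow> f x = g x"
  shows "smooth_fun A W g"
proof (rule smooth_funI)
  fix c assume c: "c \<in> A"
  show "C_infinity (snd c ` (fst c \<inter> W)) (\<lambda>z. g (inv_into (fst c) (snd c) z))"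
    by (rule C_infinity_cong[OF smooth_funD[OF assms(1) c] chart_image_open[OF c assms(2)]])
      (use chart_inverse[OF c] assms(3) in auto)
qed

lemma smooth_fun_local:
  assumes "\<And>x. x \<in> W \<Longrightarrow> \<exists>V. open V \<and> x \<in> V \<and> smooth_fun A V f"
  shows "smooth_fun A W f"
proof (rule smooth_funI, rule C_infinity_local)
  fix c z assume c: "c \<in> A" and "z \<in> snd c ` (fst c \<inter> W)"
  then obtain x where x: "x \<in> fst c" "x \<in> W" "z = snd c x" by auto
  then obtain V where "open V" "x \<in> V" "smooth_fun A V f" using assms by blast
  then show "\<exists>V. open V \<and> z \<in> V \<and> C_infinity V (\<lambda>z. f (inv_into (fst c) (snd c) z))"
    using c x by (intro exI[of _ "snd c ` (fst c \<inter> V)"]) (auto simp: chart_image_open smooth_funD)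
qed

lemma smooth_fun_const: "smooth_fun A W (\<lambda>x. k)"
  by (rule smooth_funI) (rule C_infinity_const)

lemma smooth_fun_add:
  "open W \<Longrightarrow> smooth_fun A W f \<Longrightarrow> smooth_fun A W g \<Longrightarrow> smooth_fun A W (\<lambda>x. f x + g x)"
  by (intro smooth_funI C_infinity_add) (simp_all add: chart_image_open smooth_funD)

lemma smooth_fun_mult:
  "open W \<Longrightarrow> smooth_fun A W f \<Longrightarrow> smooth_fun A W g \<Longrightarrow> smooth_fun A W (\<lambda>x. f x * g x)"
  by (intro smooth_funI C_infinity_mult) (simp_all add: chart_image_open smooth_funD)

lemma smooth_fun_cnj: "open W \<Longrightarrow> smooth_fun A W f \<Longrightarrow> smooth_fun A W (\<lambda>x. cnj (f x))"
  by (intro smooth_funI C_infinity_bounded_linear[OF bounded_linear_cnj])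
    (simp_all add: chart_image_open smooth_funD)

lemma holomorphic_imp_smooth_fun: "holomorphic_fun A W f \<Longrightarrow> smooth_fun A W f"
  unfolding holomorphic_fun_def smooth_fun_def holomorphic_Cn_def by blast

lemma smooth_nearI: "smooth_fun A W f \<Longrightarrow> open W \<Longrightarrow> x \<in> W \<Longrightarrow> smooth_near A x f"
  unfolding smooth_near_def by blast

lemma smooth_near_cong:
  assumes "open W" "x \<in> W" "\<And>y. y \<in> W \<Longrightarrow> f y = g y" "smooth_near A x f"
  shows "smooth_near A x g"
proof -
  obtain V where V: "open V" "x \<in> V" "smooth_fun A V f"
    using assms(4) unfolding smooth_near_def by blast
  have "smooth_fun A (V \<inter> W) g"
    by (rule smooth_fun_cong[OF smooth_fun_subset[OF V(3)]]) (use V assms in auto)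
  then show ?thesis by (rule smooth_nearI) (use V assms in auto)
qed

lemma smooth_near_cnj: "smooth_near A x (\<lambda>y. cnj (f y)) = smooth_near A x f"
proof
  show "smooth_near A x f" if "smooth_near A x (\<lambda>y. cnj (f y))"
    using that smooth_fun_cnj[of _ "\<lambda>y. cnj (f y)"] unfolding smooth_near_def by auto
qed (auto simp: smooth_near_def intro: smooth_fun_cnj)

lemma smooth_near_differentiable:
  assumes "smooth_near A x f" "c \<in> A" "x \<in> fst c"
  shows "(\<lambda>z. f (inv_into (fst c) (snd c) z)) differentiable (at (snd c x))"
proof -
  obtain W where "open W" "x \<in> W" "smooth_fun A W f"
    using assms(1) unfolding smooth_near_def by blast
  then show ?thesis using assms by (intro C_infinity_differentiable[OF smooth_funD]) auto
qed


section \<open>Tangent vectors\<close>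

text \<open>A complex tangent vector is \<open>u + \<i> w\<close> for real tangent vectors \<open>u\<close> and \<open>w\<close>. In this form
  it acts through the real derivative, so that changes of charts and Lie brackets need only the
  chain rule and the symmetry of the second derivative.\<close>

definition real_tvec ::
  "('x, 'n) chart \<Rightarrow> 'x \<Rightarrow> complex ^ 'n \<Rightarrow> complex ^ 'n \<Rightarrow> 'x tvec"
  where "real_tvec c x u w = (\<lambda>f.
    if smooth_near A x f then
      frechet_derivative (\<lambda>z. f (inv_into (fst c) (snd c) z)) (at (snd c x)) u +
      \<i> * frechet_derivative (\<lambda>z. f (inv_into (fst c) (snd c) z)) (at (snd c x)) w
    else 0)"

text \<open>The real vectors \<open>u\<close> and \<open>w\<close> solve \<open>u + \<i> w = a\<close> and \<open>u - \<i> w = cnj b\<close>, by comparison of the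
  coefficients of the real partial derivatives.\<close>

lemma coord_tvec_eq_real_tvec:
  assumes "c \<in> A" "x \<in> fst c"
  shows "coord_tvec A c x a b =
    real_tvec c x (\<chi> i. (a $ i + cnj (b $ i)) / 2) (\<chi> i. \<i> * (cnj (b $ i) - a $ i) / 2)"
proof
  fix f
  show "coord_tvec A c x a b f =
    real_tvec c x (\<chi> i. (a $ i + cnj (b $ i)) / 2) (\<chi> i. \<i> * (cnj (b $ i) - a $ i) / 2) f"
  proof (cases "smooth_near A x f")
    case True
    let ?D = "frechet_derivative (\<lambda>z. f (inv_into (fst c) (snd c) z)) (at (snd c x))"
    have "linear ?D"
      using linear_frechet_derivative smooth_near_differentiable[OF True assms] by blast
    then have D: "?D u = (\<Sum>i\<in>UNIV. of_real (Re (u $ i)) * ?D (axis i 1)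
        + of_real (Im (u $ i)) * ?D (axis i \<i>))" for u
      by (rule linear_sum_axis)
    have "a' * ((X - \<i> * Y) / 2) + b' * ((X + \<i> * Y) / 2)
      = of_real (Re ((a' + cnj b') / 2)) * X + of_real (Im ((a' + cnj b') / 2)) * Y
        + \<i> * (of_real (Re (\<i> * (cnj b' - a') / 2)) * X
          + of_real (Im (\<i> * (cnj b' - a') / 2)) * Y)"
      for a' b' X Y :: complex
      by (simp add: complex_eq_iff field_simps)
    then show ?thesis
      using True unfolding coord_tvec_def real_tvec_def wirtinger_def wirtinger_bar_def
      by (simp add: D[of "\<chi> i. _ i"] sum_distrib_left flip: sum.distrib)
  qed (simp add: coord_tvec_def real_tvec_def)
qed

lemma real_tvec_eq_coord_tvec:
  assumes "c \<in> A" "x \<in> fst c"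
  shows "real_tvec c x u w =
    coord_tvec A c x (\<chi> i. u $ i + \<i> * w $ i) (\<chi> i. cnj (u $ i - \<i> * w $ i))"
  unfolding coord_tvec_eq_real_tvec[OF assms]
  by (rule arg_cong2[where f = "real_tvec c x"]) (simp_all add: vec_eq_iff algebra_simps)

lemma real_tvec_in_tangent: "c \<in> A \<Longrightarrow> x \<in> fst c \<Longrightarrow> real_tvec c x u w \<in> tangent A x"
  unfolding tangent_def using real_tvec_eq_coord_tvec by blast

lemma real_tvec_change_chart:
  assumes c: "c \<in> A" "x \<in> fst c" and c': "c' \<in> A" "x \<in> fst c'"
  defines "T \<equiv> frechet_derivative (\<lambda>z. snd c (inv_into (fst c') (snd c') z)) (at (snd c' x))"
  shows "real_tvec c' x u w = real_tvec c x (T u) (T w)"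
proof
  fix f :: "'x \<Rightarrow> complex"
  let ?\<tau> = "\<lambda>z. snd c (inv_into (fst c') (snd c') z)"
  let ?F = "\<lambda>z. f (inv_into (fst c) (snd c) z)"
  let ?Z = "snd c' ` (fst c' \<inter> fst c)"
  have Z: "open ?Z" "snd c' x \<in> ?Z"
    using chart_image_open[OF c'(1) chart_domain_open[OF c(1)]] assms by auto
  have hol: "holomorphic_Cn ?Z (\<lambda>z. ?\<tau> z $ i)" for i
    by (rule transition_holomorphic[OF c'(1) c(1)])
  have \<tau>: "?\<tau> differentiable (at (snd c' x))"
    by (intro differentiable_vec C_infinity_differentiable[OF _ Z(2)])
      (use hol in \<open>simp add: holomorphic_Cn_def\<close>)
  show "real_tvec c' x u w f = real_tvec c x (T u) (T w) f"
  proof (cases "smooth_near A x f")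
    case True
    have F: "?F differentiable (at (snd c x))"
      using smooth_near_differentiable[OF True c] .
    have \<tau>x: "?\<tau> (snd c' x) = snd c x" using chart_inverse[OF c'] by simp
    have "frechet_derivative (\<lambda>z. f (inv_into (fst c') (snd c') z)) (at (snd c' x))
        = frechet_derivative (?F \<circ> ?\<tau>) (at (snd c' x))"
      by (rule frechet_derivative_transform_within_open[OF _ Z])
        (use smooth_near_differentiable[OF True c'] c c' in \<open>auto simp: chart_inverse\<close>)
    also have "\<dots> = frechet_derivative ?F (at (snd c x)) \<circ> T"
      unfolding T_def using frechet_derivative_compose[OF \<tau>, of ?F] F unfolding \<tau>x by simp
    finally show ?thesis using True by (simp add: real_tvec_def)
  qed (simp add: real_tvec_def)
qed

lemma tangent_in_chart:
  assumes "v \<in> tangent A x" "c \<in> A" "x \<in> fst c"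
  obtains u w where "v = real_tvec c x u w"
proof -
  obtain c' a b where c': "c' \<in> A" "x \<in> fst c'" "v = coord_tvec A c' x a b"
    using assms(1) unfolding tangent_def by auto
  show ?thesis
    by (rule that)
      (unfold c'(3) coord_tvec_eq_real_tvec[OF c'(1,2)], rule real_tvec_change_chart[OF assms(2,3) c'(1,2)])
qed

lemma tangent_local:
  assumes "v \<in> tangent A x" "open W" "x \<in> W" "\<And>y. y \<in> W \<Longrightarrow> f y = g y"
  shows "v f = v g"
proof -
  obtain c a b where c: "c \<in> A" "x \<in> fst c" "v = coord_tvec A c x a b"
    using assms(1) unfolding tangent_def by auto
  have near: "smooth_near A x f = smooth_near A x g"
    using smooth_near_cong[OF assms(2,3)] assms(4) by metis
  have "frechet_derivative (\<lambda>z. f (inv_into (fst c) (snd c) z)) (at (snd c x))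
      = frechet_derivative (\<lambda>z. g (inv_into (fst c) (snd c) z)) (at (snd c x))"
    if "smooth_near A x f"
    by (rule frechet_derivative_transform_within_open[OF smooth_near_differentiable[OF that c(1,2)]
          chart_image_open[OF c(1) assms(2)]])
      (use c assms in \<open>auto simp: chart_inverse\<close>)
  then show ?thesis
    using near unfolding c(3) coord_tvec_eq_real_tvec[OF c(1,2)] real_tvec_def by simp
qed

lemma tangent10_subset: "tangent10 A x \<subseteq> tangent A x"
  unfolding tangent10_def tangent_def by blast

lemma tangent01_subset: "tangent01 A x \<subseteq> tangent A x"
  unfolding tangent01_def tangent_def by blast

lemma tangent_decomposition:
  assumes "v \<in> tangent A x"
  obtains v' v'' where "v' \<in> tangent10 A x" "v'' \<in> tangent01 A x" "v = (\<lambda>f. v' f + v'' f)"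
proof -
  obtain c a b where c: "c \<in> A" "x \<in> fst c" "v = coord_tvec A c x a b"
    using assms(1) unfolding tangent_def by auto
  have "v = (\<lambda>f. coord_tvec A c x a 0 f + coord_tvec A c x 0 b f)"
    unfolding c(3) coord_tvec_def by (auto simp: sum.distrib)
  then show ?thesis using that c(1,2) unfolding tangent10_def tangent01_def by blast
qed

lemma tangent01_holomorphic:
  assumes "v \<in> tangent01 A x" "holomorphic_fun A W f" "x \<in> W"
  shows "v f = 0"
proof -
  obtain c b where c: "c \<in> A" "x \<in> fst c" "v = coord_tvec A c x 0 b"
    using assms(1) unfolding tangent01_def by auto
  have "holomorphic_Cn (snd c ` (fst c \<inter> W)) (\<lambda>z. f (inv_into (fst c) (snd c) z))"
    using assms(2) c(1) unfolding holomorphic_fun_def by (cases c) auto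
  then show ?thesis
    using c assms(3) unfolding holomorphic_Cn_def coord_tvec_def by auto
qed

lemma tangent_zero: "v \<in> tangent A x \<Longrightarrow> v (\<lambda>y. 0) = 0"
  unfolding tangent_def coord_tvec_def wirtinger_def wirtinger_bar_def by auto

lemma conj_tvec_conj_tvec: "conj_tvec (conj_tvec v) = v"
  unfolding conj_tvec_def by simp

lemma conj_real_tvec:
  assumes "c \<in> A" "x \<in> fst c"
  shows "conj_tvec (real_tvec c x u w) = real_tvec c x u (- w)"
proof
  fix f
  show "conj_tvec (real_tvec c x u w) f = real_tvec c x u (- w) f"
  proof (cases "smooth_near A x f")
    case True
    note F = smooth_near_differentiable[OF True assms]
    show ?thesis
      using True linear_neg[OF linear_frechet_derivative[OF F]]
      unfolding conj_tvec_def real_tvec_def smooth_near_cnj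
        frechet_derivative_bounded_linear[OF bounded_linear_cnj F] by simp
  qed (simp add: conj_tvec_def real_tvec_def smooth_near_cnj)
qed

lemma conj_tvec_tangent:
  assumes "v \<in> tangent A x"
  shows "conj_tvec v \<in> tangent A x"
proof -
  obtain c where c: "c \<in> A" "x \<in> fst c" using chart_obtain .
  obtain u w where "v = real_tvec c x u w" using tangent_in_chart[OF assms c] .
  then show ?thesis by (simp add: conj_real_tvec[OF c] real_tvec_in_tangent[OF c])
qed

lemma conj_tvec_tangent10:
  assumes "v \<in> tangent10 A x"
  shows "conj_tvec v \<in> tangent01 A x"
proof -
  obtain c a where c: "c \<in> A" "x \<in> fst c" "v = coord_tvec A c x a 0"
    using assms(1) unfolding tangent10_def by auto
  have "conj_tvec v = coord_tvec A c x 0 (\<chi> i. cnj (a $ i))"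
    unfolding c(3) coord_tvec_eq_real_tvec[OF c(1,2)] conj_real_tvec[OF c(1,2)]
    by (rule arg_cong2[where f = "real_tvec c x"]) (simp_all add: vec_eq_iff)
  then show ?thesis using c(1,2) unfolding tangent01_def by blast
qed

lemma smooth_field_conj:
  assumes "smooth_field A U \<xi>"
  shows "smooth_field A U (\<lambda>x. conj_tvec (\<xi> x))"
  unfolding smooth_field_def
proof (intro conjI ballI allI impI)
  show "conj_tvec (\<xi> x) \<in> tangent A x" if "x \<in> U" for x
    using assms that conj_tvec_tangent unfolding smooth_field_def by blast
  show "smooth_fun A W (\<lambda>x. conj_tvec (\<xi> x) f)" if "open W \<and> W \<subseteq> U \<and> smooth_fun A W f" for W f
    using assms that smooth_fun_cnj unfolding smooth_field_def conj_tvec_def by blast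
qed


section \<open>The Lie bracket of smooth vector fields\<close>

lemma chart_coordinate_smooth:
  assumes "c \<in> A"
  shows "smooth_fun A (fst c) (\<lambda>y. snd c y $ i)"
proof (rule smooth_funI)
  fix c' assume "c' \<in> A"
  from transition_holomorphic[OF this assms]
  show "C_infinity (snd c' ` (fst c' \<inter> fst c)) (\<lambda>z. snd c (inv_into (fst c') (snd c') z) $ i)"
    by (simp add: holomorphic_Cn_def)
qed

lemma real_tvec_coordinate:
  assumes c: "c \<in> A" "x \<in> fst c"
  shows "real_tvec c x u w (\<lambda>y. snd c y $ i) = u $ i + \<i> * w $ i"
proof -
  have "smooth_near A x (\<lambda>y. snd c y $ i)"
    by (rule smooth_nearI[OF chart_coordinate_smooth[OF c(1)] chart_domain_open[OF c(1)] c(2)])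
  moreover have "frechet_derivative (\<lambda>z. snd c (inv_into (fst c) (snd c) z) $ i) (at (snd c x)) h
      = h $ i" for h
  proof -
    have "frechet_derivative (\<lambda>z. z $ i) (at (snd c x))
        = frechet_derivative (\<lambda>z. snd c (inv_into (fst c) (snd c) z) $ i) (at (snd c x))"
    proof (rule frechet_derivative_transform_within_open)
      show "open (snd c ` (fst c \<inter> UNIV))" using chart_image_open[OF c(1)] by blast
    qed (use c in \<open>auto simp: chart_inverse bounded_linear_imp_differentiable bounded_linear_vec_nth\<close>)
    then show ?thesis
      using frechet_derivative_at[OF bounded_linear_imp_has_derivative[OF bounded_linear_vec_nth]]
      by metis
  qed
  ultimately show ?thesis by (simp add: real_tvec_def)
qed

text \<open>The coefficients \<open>u\<close> and \<open>w\<close> are recovered from the values of \<open>u + \<i> w\<close> and of its conjugate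
  on the coordinate functions; this makes them smooth when the field is.\<close>

lemma smooth_field_in_chart:
  assumes \<xi>: "smooth_field A U \<xi>" and U: "open U" and c: "c \<in> A"
  obtains u w where "\<And>y. y \<in> U \<inter> fst c \<Longrightarrow> \<xi> y = real_tvec c y (u (snd c y)) (w (snd c y))"
    "\<And>y. y \<in> U \<inter> fst c \<Longrightarrow> u differentiable (at (snd c y))"
    "\<And>y. y \<in> U \<inter> fst c \<Longrightarrow> w differentiable (at (snd c y))"
proof -
  let ?\<psi> = "inv_into (fst c) (snd c)" and ?Z = "snd c ` (fst c \<inter> (U \<inter> fst c))"
  have "\<exists>u w. \<xi> y = real_tvec c y u w" if "y \<in> U \<inter> fst c" for y
    using \<xi> that tangent_in_chart[OF _ c] unfolding smooth_field_def by (metis IntE)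
  then obtain u w where uw: "\<And>y. y \<in> U \<inter> fst c \<Longrightarrow> \<xi> y = real_tvec c y (u y) (w y)"
    by metis
  have open': "open (U \<inter> fst c)" using U chart_domain_open[OF c] by blast
  have coord: "smooth_fun A (U \<inter> fst c) (\<lambda>y. snd c y $ i)" for i
    by (rule smooth_fun_subset[OF chart_coordinate_smooth[OF c]]) simp
  have p: "smooth_fun A (U \<inter> fst c) (\<lambda>y. \<xi> y (\<lambda>y. snd c y $ i))" for i
    using \<xi> open' coord unfolding smooth_field_def by blast
  have r: "smooth_fun A (U \<inter> fst c) (\<lambda>y. conj_tvec (\<xi> y) (\<lambda>y. snd c y $ i))" for i
    using smooth_field_conj[OF \<xi>] open' coord unfolding smooth_field_def by blast
  have eq: "\<xi> y (\<lambda>y. snd c y $ i) = u y $ i + \<i> * w y $ i"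
    "conj_tvec (\<xi> y) (\<lambda>y. snd c y $ i) = u y $ i - \<i> * w y $ i" if "y \<in> U \<inter> fst c" for y i
    using that by (auto simp: uw conj_real_tvec c real_tvec_coordinate)
  have u: "smooth_fun A (U \<inter> fst c) (\<lambda>y. u y $ i)" for i
    by (rule smooth_fun_cong[OF smooth_fun_mult[OF open' smooth_fun_const[of _ "1/2"]
            smooth_fun_add[OF open' p[of i] r[of i]]] open'])
      (simp add: eq)
  have w: "smooth_fun A (U \<inter> fst c) (\<lambda>y. w y $ i)" for i
    by (rule smooth_fun_cong[OF smooth_fun_mult[OF open' smooth_fun_const[of _ "-\<i>/2"]
            smooth_fun_add[OF open' p[of i] smooth_fun_mult[OF open' smooth_fun_const[of _ "-1"]
              r[of i]]]] open'])
      (simp add: eq algebra_simps)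
  show ?thesis
  proof (rule that[of "\<lambda>z. u (?\<psi> z)" "\<lambda>z. w (?\<psi> z)"])
    fix y assume y: "y \<in> U \<inter> fst c"
    then show "\<xi> y = real_tvec c y (u (?\<psi> (snd c y))) (w (?\<psi> (snd c y)))"
      by (simp add: uw c chart_inverse)
    show "(\<lambda>z. u (?\<psi> z)) differentiable (at (snd c y))" "(\<lambda>z. w (?\<psi> z)) differentiable (at (snd c y))"
      by (rule differentiable_vec, rule C_infinity_differentiable[OF smooth_funD[OF _ c]],
          rule u w, use y in blast)+
  qed
qed

text \<open>In a chart, \<open>\<xi> (\<eta> f) - \<eta> (\<xi> f)\<close> consists of first derivatives of \<open>f\<close> along derivatives of the
  coefficients and of second derivatives of \<open>f\<close>; the latter cancel by symmetry.\<close>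

lemma lie_bracket_tangent:
  assumes \<xi>: "smooth_field A U \<xi>" and \<eta>: "smooth_field A U \<eta>" and U: "open U" "x \<in> U"
  shows "lie_bracket A \<xi> \<eta> x \<in> tangent A x"
proof -
  obtain c where c: "c \<in> A" "x \<in> fst c" using chart_obtain .
  let ?\<psi> = "inv_into (fst c) (snd c)" and ?p = "snd c x"
  obtain u w where uw: "\<forall>y\<in>U \<inter> fst c. \<xi> y = real_tvec c y (u (snd c y)) (w (snd c y))"
    and duw: "u differentiable (at ?p)" "w differentiable (at ?p)"
    using smooth_field_in_chart[OF \<xi> U(1) c(1)] c(2) U(2) by (metis IntI)
  obtain u' w' where uw': "\<forall>y\<in>U \<inter> fst c. \<eta> y = real_tvec c y (u' (snd c y)) (w' (snd c y))"
    and duw': "u' differentiable (at ?p)" "w' differentiable (at ?p)"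
    using smooth_field_in_chart[OF \<eta> U(1) c(1)] c(2) U(2) by (metis IntI)
  have xV: "x \<in> U \<inter> fst c" using c U by blast
  define d where "d g h = frechet_derivative g (at ?p) h" for g :: "complex ^ 'n \<Rightarrow> complex ^ 'n" and h
  have iterate: "(real_tvec c x a b) (\<lambda>y. \<zeta> y f) =
      second_derivative F ?p a (u1 ?p) + frechet_derivative F (at ?p) (d u1 a)
      + \<i> * (second_derivative F ?p a (w1 ?p) + frechet_derivative F (at ?p) (d w1 a))
      + \<i> * (second_derivative F ?p b (u1 ?p) + frechet_derivative F (at ?p) (d u1 b)
      + \<i> * (second_derivative F ?p b (w1 ?p) + frechet_derivative F (at ?p) (d w1 b)))"
    if f: "smooth_near A x f" and F: "F = (\<lambda>z. f (?\<psi> z))" and \<zeta>: "smooth_field A U \<zeta>"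
      "\<forall>y\<in>U \<inter> fst c. \<zeta> y = real_tvec c y (u1 (snd c y)) (w1 (snd c y))"
      and d1: "u1 differentiable (at ?p)" "w1 differentiable (at ?p)" for f F \<zeta> u1 w1 a b
  proof -
    obtain W where W: "open W" "x \<in> W" "smooth_fun A W f"
      using f unfolding smooth_near_def by blast
    define W' where "W' = W \<inter> (U \<inter> fst c)"
    have W': "open W'" "x \<in> W'" "smooth_fun A W' f" "W' \<subseteq> U \<inter> fst c"
      using W U c chart_domain_open[OF c(1)] smooth_fun_subset[OF W(3), of W'] unfolding W'_def
      by auto
    let ?Z = "snd c ` (fst c \<inter> W')"
    have Z: "open ?Z" "?p \<in> ?Z" using chart_image_open[OF c(1) W'(1)] c W' by auto
    have FZ: "C_infinity ?Z F" unfolding F using smooth_funD[OF W'(3) c(1)] .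
    have \<zeta>f: "smooth_near A x (\<lambda>y. \<zeta> y f)"
      using \<zeta>(1) W' by (intro smooth_nearI[of W']) (auto simp: smooth_field_def)
    have "((\<lambda>z. frechet_derivative F (at z) (u1 z) + \<i> * frechet_derivative F (at z) (w1 z))
      has_derivative (\<lambda>h. (second_derivative F ?p h (u1 ?p) + frechet_derivative F (at ?p) (d u1 h))
      + \<i> * (second_derivative F ?p h (w1 ?p) + frechet_derivative F (at ?p) (d w1 h)))) (at ?p)"
      unfolding d_def
      by (intro has_derivative_add has_derivative_mult_right
          has_derivative_directional_derivative[OF FZ Z] d1)
    then have "((\<lambda>z. \<zeta> (?\<psi> z) f)
      has_derivative (\<lambda>h. (second_derivative F ?p h (u1 ?p) + frechet_derivative F (at ?p) (d u1 h))
      + \<i> * (second_derivative F ?p h (w1 ?p) + frechet_derivative F (at ?p) (d w1 h)))) (at ?p)"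
    proof (rule has_derivative_transform_within_open[OF _ Z])
      fix z assume "z \<in> ?Z"
      then obtain y where y: "y \<in> W'" "y \<in> fst c" "z = snd c y" by auto
      then show "frechet_derivative F (at z) (u1 z) + \<i> * frechet_derivative F (at z) (w1 z)
          = \<zeta> (?\<psi> z) f"
        using \<zeta>(2) W' smooth_nearI[OF W'(3,1)]
        by (auto simp: chart_inverse c real_tvec_def F)
    qed
    from frechet_derivative_at[OF this] \<zeta>f show ?thesis
      unfolding real_tvec_def by (metis (no_types, lifting))
  qed
  define a where "a = d u' (u ?p) - d w' (w ?p) - d u (u' ?p) + d w (w' ?p)"
  define b where "b = d u' (w ?p) + d w' (u ?p) - d u (w' ?p) - d w (u' ?p)"
  have "lie_bracket A \<xi> \<eta> x f = real_tvec c x a b f" for f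
  proof (cases "smooth_near A x f")
    case True
    define F where "F = (\<lambda>z. f (?\<psi> z))"
    obtain W where W: "open W" "x \<in> W" "smooth_fun A W f"
      using True unfolding smooth_near_def by blast
    let ?Z = "snd c ` (fst c \<inter> W)"
    have Z: "open ?Z" "?p \<in> ?Z" using chart_image_open[OF c(1) W(1)] c W by auto
    have FZ: "C_infinity ?Z F" unfolding F_def using smooth_funD[OF W(3) c(1)] .
    note sym = second_derivative_symmetric[OF FZ Z]
    have lin: "linear (frechet_derivative F (at ?p))"
      using C_infinity_differentiable[OF FZ Z(2)] by (rule linear_frechet_derivative)
    have rhs: "real_tvec c x a b f
        = frechet_derivative F (at ?p) a + \<i> * frechet_derivative F (at ?p) b"
      using True by (simp add: real_tvec_def F_def)
    have lhs: "lie_bracket A \<xi> \<eta> x f = real_tvec c x (u ?p) (w ?p) (\<lambda>y. \<eta> y f)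
        - real_tvec c x (u' ?p) (w' ?p) (\<lambda>y. \<xi> y f)"
      using True by (simp add: lie_bracket_def bspec[OF uw xV] bspec[OF uw' xV])
    show ?thesis
      unfolding lhs rhs iterate[OF True F_def \<xi> uw duw] iterate[OF True F_def \<eta> uw' duw']
        sym[of "u' ?p" "u ?p"] sym[of "u' ?p" "w ?p"] sym[of "w' ?p" "u ?p"] sym[of "w' ?p" "w ?p"]
      by (simp add: a_def b_def linear_add[OF lin] linear_diff[OF lin] algebra_simps)
  qed (simp add: lie_bracket_def real_tvec_def)
  then have "lie_bracket A \<xi> \<eta> x = real_tvec c x a b" by blast
  then show ?thesis using real_tvec_in_tangent[OF c] by simp
qed

end


section \<open>Sections of holomorphic vector bundles\<close>

lemma clinear_between_sum:
  assumes f: "clinear_between V W f" and V: "complex_vector.subspace V"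
    and v: "\<And>i. i \<in> I \<Longrightarrow> v i \<in> V"
  shows "f (\<Sum>i\<in>I. c i *\<^sub>C v i) = (\<Sum>i\<in>I. c i *\<^sub>C f (v i))"
proof -
  have "f (0 *\<^sub>C 0) = 0 *\<^sub>C f 0"
    using f complex_vector.subspace_0[OF V] unfolding clinear_between_def by blast
  then have zero: "f 0 = 0" by simp
  show ?thesis
    using v
  proof (induction I rule: infinite_finite_induct)
    case (insert i I)
    then have "c i *\<^sub>C v i \<in> V" "(\<Sum>i\<in>I. c i *\<^sub>C v i) \<in> V"
      by (auto intro!: complex_vector.subspace_scale complex_vector.subspace_sum V)
    then show ?case using f insert unfolding clinear_between_def by auto
  qed (auto simp: zero)
qed

lemma clinear_between_diff:
  assumes f: "clinear_between V W f" and V: "complex_vector.subspace V"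
    and uv: "u \<in> V" "v \<in> V"
  shows "f (u - v) = f u - f v"
proof -
  have "f (u - v) + f v = f u"
    using f uv complex_vector.subspace_diff[OF V uv] unfolding clinear_between_def
    by (metis diff_add_cancel)
  then show ?thesis by (simp add: eq_diff_eq)
qed

lemma fiber_subspace: "holomorphic_bundle A E \<Longrightarrow> complex_vector.subspace (fiber E x)"
  unfolding holomorphic_bundle_def by blast

lemma frame_bij_betw:
  "holomorphic_bundle A E \<Longrightarrow> (V, r, e) \<in> frames E \<Longrightarrow> x \<in> V \<Longrightarrow>
    bij_betw (frame_comb r e x) (coord_space r) (fiber E x)"
  unfolding holomorphic_bundle_def by blast

lemma frame_open: "holomorphic_bundle A E \<Longrightarrow> (V, r, e) \<in> frames E \<Longrightarrow> open V"
  unfolding holomorphic_bundle_def by blast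

lemma frame_holomorphic:
  "holomorphic_bundle A E \<Longrightarrow> (V, r, e) \<in> frames E \<Longrightarrow> k < r \<Longrightarrow> holomorphic_section A E V (e k)"
  unfolding holomorphic_bundle_def by blast

lemma frame_in_fiber:
  "holomorphic_bundle A E \<Longrightarrow> (V, r, e) \<in> frames E \<Longrightarrow> x \<in> V \<Longrightarrow> k < r \<Longrightarrow> e k x \<in> fiber E x"
  using frame_holomorphic unfolding holomorphic_section_def by blast

lemma frame_obtain:
  assumes "holomorphic_bundle A E"
  obtains V r e where "(V, r, e) \<in> frames E" "x \<in> V"
proof -
  have "x \<in> (\<Union>(U, r, e)\<in>frames E. U)" using assms unfolding holomorphic_bundle_def by simp
  then show ?thesis using that by auto
qed

lemma frame_expansion:
  assumes "holomorphic_bundle A E" "(V, r, e) \<in> frames E" "x \<in> V" "v \<in> fiber E x"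
  shows "(\<Sum>i<r. frame_coord r e x v i *\<^sub>C e i x) = v"
  using f_the_inv_into_f_bij_betw[OF frame_bij_betw[OF assms(1-3)] assms(4)]
  unfolding frame_coord_def frame_comb_def .

lemma frame_coord_combination:
  assumes "holomorphic_bundle A E" "(V, r, e) \<in> frames E" "x \<in> V" "k < r"
  shows "frame_coord r e x (\<Sum>i<r. c i *\<^sub>C e i x) k = c k"
proof -
  \<comment> \<open>The frame is bijective on coefficients that vanish from index \<open>r\<close> on.\<close>
  define c' where "c' i = (if i < r then c i else 0)" for i
  have c': "c' \<in> coord_space r" by (simp add: coord_space_def c'_def)
  have "frame_comb r e x c' = (\<Sum>i<r. c i *\<^sub>C e i x)"
    unfolding frame_comb_def c'_def by (rule sum.cong) auto
  then have "frame_coord r e x (\<Sum>i<r. c i *\<^sub>C e i x) = c'"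
    using the_inv_into_f_f[OF bij_betw_imp_inj_on[OF frame_bij_betw[OF assms(1-3)]] c']
    unfolding frame_coord_def by simp
  then show ?thesis using assms(4) by (simp add: c'_def)
qed

lemma frame_coord_add:
  assumes E: "holomorphic_bundle A E" "(V, r, e) \<in> frames E" "x \<in> V"
    and "u \<in> fiber E x" "v \<in> fiber E x" "k < r"
  shows "frame_coord r e x (u + v) k = frame_coord r e x u k + frame_coord r e x v k"
proof -
  have "u + v = (\<Sum>i<r. (frame_coord r e x u i + frame_coord r e x v i) *\<^sub>C e i x)"
    using frame_expansion[OF E] assms(4,5) by (simp add: scaleC_add_left sum.distrib)
  then show ?thesis
    using frame_coord_combination[OF E assms(6),
        of "\<lambda>i. frame_coord r e x u i + frame_coord r e x v i"] by simp
qed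

lemma frame_coord_scale:
  assumes E: "holomorphic_bundle A E" "(V, r, e) \<in> frames E" "x \<in> V"
    and "u \<in> fiber E x" "k < r"
  shows "frame_coord r e x (a *\<^sub>C u) k = a * frame_coord r e x u k"
proof -
  have "a *\<^sub>C u = (\<Sum>i<r. (a * frame_coord r e x u i) *\<^sub>C e i x)"
    using arg_cong[OF frame_expansion[OF E assms(4)], of "scaleC a"]
    by (simp add: complex_vector.scale_sum_right)
  then show ?thesis
    using frame_coord_combination[OF E assms(5), of "\<lambda>i. a * frame_coord r e x u i"] by simp
qed

lemma smooth_section_in_fiber: "smooth_section A E U s \<Longrightarrow> x \<in> U \<Longrightarrow> s x \<in> fiber E x"
  unfolding smooth_section_def by blast

lemma smooth_section_coord:
  "smooth_section A E U s \<Longrightarrow> (V, r, e) \<in> frames E \<Longrightarrow> i < r \<Longrightarrow>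
    smooth_fun A (U \<inter> V) (\<lambda>x. frame_coord r e x (s x) i)"
  unfolding smooth_section_def by blast

lemma smooth_sectionI:
  assumes "\<And>x. x \<in> U \<Longrightarrow> s x \<in> fiber E x"
    and "\<And>V r e i. (V, r, e) \<in> frames E \<Longrightarrow> i < r \<Longrightarrow>
      smooth_fun A (U \<inter> V) (\<lambda>x. frame_coord r e x (s x) i)"
  shows "smooth_section A E U s"
  using assms unfolding smooth_section_def by blast

context atlas
begin

lemma holomorphic_imp_smooth_section:
  "holomorphic_section A E U s \<Longrightarrow> smooth_section A E U s"
  unfolding holomorphic_section_def smooth_section_def
  using holomorphic_imp_smooth_fun by blast

lemma smooth_section_subset:
  assumes "smooth_section A E U s" "V \<subseteq> U"
  shows "smooth_section A E V s"
  using assms smooth_section_in_fiber[OF assms(1)]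
  by (auto intro!: smooth_sectionI smooth_fun_subset[OF smooth_section_coord[OF assms(1)]])

lemma smooth_section_cong:
  assumes E: "holomorphic_bundle A E" and s: "smooth_section A E U s" and U: "open U"
    and eq: "\<And>x. x \<in> U \<Longrightarrow> s x = t x"
  shows "smooth_section A E U t"
proof (rule smooth_sectionI)
  show "t x \<in> fiber E x" if "x \<in> U" for x
    using smooth_section_in_fiber[OF s that] eq[OF that] by simp
  show "smooth_fun A (U \<inter> V) (\<lambda>x. frame_coord r e x (t x) i)"
    if V: "(V, r, e) \<in> frames E" "i < r" for V r e i
    using smooth_section_coord[OF s V] U frame_open[OF E V(1)]
    by (rule smooth_fun_cong[OF _ open_Int]) (simp add: eq)
qed

lemma smooth_section_local:
  assumes E: "holomorphic_bundle A E"
    and s: "\<And>x. x \<in> U \<Longrightarrow> \<exists>W. open W \<and> x \<in> W \<and> smooth_section A E W s"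
  shows "smooth_section A E U s"
proof (rule smooth_sectionI)
  show "s x \<in> fiber E x" if "x \<in> U" for x
    using s[OF that] smooth_section_in_fiber by blast
  fix V r e i assume V: "(V, r, e) \<in> frames E" "i < r"
  show "smooth_fun A (U \<inter> V) (\<lambda>x. frame_coord r e x (s x) i)"
  proof (rule smooth_fun_local)
    fix x assume "x \<in> U \<inter> V"
    then obtain W where "open W" "x \<in> W" "smooth_section A E W s" "x \<in> V" using s by blast
    then show "\<exists>W. open W \<and> x \<in> W \<and> smooth_fun A W (\<lambda>x. frame_coord r e x (s x) i)"
      using smooth_section_coord[OF _ V] frame_open[OF E V(1)]
      by (intro exI[of _ "W \<inter> V"]) auto
  qed
qed

lemma smooth_section_add:
  assumes E: "holomorphic_bundle A E" and U: "open U"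
    and s: "smooth_section A E U s" and t: "smooth_section A E U t"
  shows "smooth_section A E U (\<lambda>x. s x + t x)"
proof (rule smooth_sectionI)
  show "s x + t x \<in> fiber E x" if "x \<in> U" for x
    using that s t by (auto intro!: complex_vector.subspace_add fiber_subspace[OF E]
        elim!: smooth_section_in_fiber)
  show "smooth_fun A (U \<inter> V) (\<lambda>x. frame_coord r e x (s x + t x) i)"
    if V: "(V, r, e) \<in> frames E" "i < r" for V r e i
  proof -
    have UV: "open (U \<inter> V)" using U frame_open[OF E V(1)] by blast
    show ?thesis
      by (rule smooth_fun_cong[OF smooth_fun_add[OF UV smooth_section_coord[OF s V]
              smooth_section_coord[OF t V]] UV])
        (use V s t in \<open>simp add: frame_coord_add[OF E] smooth_section_in_fiber\<close>)
  qed
qed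

lemma smooth_section_scale:
  assumes E: "holomorphic_bundle A E" and U: "open U"
    and f: "smooth_fun A U f" and s: "smooth_section A E U s"
  shows "smooth_section A E U (\<lambda>x. f x *\<^sub>C s x)"
proof (rule smooth_sectionI)
  show "f x *\<^sub>C s x \<in> fiber E x" if "x \<in> U" for x
    using that s by (auto intro!: complex_vector.subspace_scale fiber_subspace[OF E]
        elim!: smooth_section_in_fiber)
  show "smooth_fun A (U \<inter> V) (\<lambda>x. frame_coord r e x (f x *\<^sub>C s x) i)"
    if V: "(V, r, e) \<in> frames E" "i < r" for V r e i
  proof -
    have UV: "open (U \<inter> V)" using U frame_open[OF E V(1)] by blast
    have "smooth_fun A (U \<inter> V) f" by (rule smooth_fun_subset[OF f]) simp
    then show ?thesis
      by (rule smooth_fun_cong[OF smooth_fun_mult[OF UV _ smooth_section_coord[OF s V]] UV])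
        (use V s in \<open>simp add: frame_coord_scale[OF E] smooth_section_in_fiber\<close>)
  qed
qed

lemma smooth_section_combination:
  assumes E: "holomorphic_bundle A E" and U: "open U" and I: "finite I"
    and f: "\<And>i. i \<in> I \<Longrightarrow> smooth_fun A U (f i)"
    and s: "\<And>i. i \<in> I \<Longrightarrow> smooth_section A E U (s i)"
  shows "smooth_section A E U (\<lambda>x. \<Sum>i\<in>I. f i x *\<^sub>C s i x)"
  using I f s
proof (induction I rule: finite_induct)
  case empty
  show ?case
  proof (rule smooth_sectionI)
    show "(\<Sum>i\<in>{}. f i x *\<^sub>C s i x) \<in> fiber E x" for x
      using complex_vector.subspace_0[OF fiber_subspace[OF E]] by simp
    show "smooth_fun A (U \<inter> V) (\<lambda>x. frame_coord r e x (\<Sum>i\<in>{}. f i x *\<^sub>C s i x) i)"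
      if V: "(V, r, e) \<in> frames E" "i < r" for V r e i
    proof (rule smooth_fun_cong[OF smooth_fun_const[of _ 0]])
      show "open (U \<inter> V)" using U frame_open[OF E V(1)] by blast
      show "0 = frame_coord r e x (\<Sum>i\<in>{}. f i x *\<^sub>C s i x) i" if "x \<in> U \<inter> V" for x
        using frame_coord_combination[OF E V(1) _ V(2), of x "\<lambda>_. 0"] that by simp
    qed
  qed
next
  case (insert i I)
  then show ?case
    by (simp add: smooth_section_add[OF E U] smooth_section_scale[OF E U])
qed

lemma section_through:
  assumes E: "holomorphic_bundle A E" and u: "u \<in> fiber E x"
  obtains U s where "open U" "x \<in> U" "smooth_section A E U s" "s x = u"
proof -
  obtain V r e where V: "(V, r, e) \<in> frames E" "x \<in> V" using frame_obtain[OF E] .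
  show ?thesis
  proof (rule that[of V "\<lambda>y. \<Sum>i<r. frame_coord r e x u i *\<^sub>C e i y"])
    show "smooth_section A E V (\<lambda>y. \<Sum>i<r. frame_coord r e x u i *\<^sub>C e i y)"
      by (intro smooth_section_combination[OF E frame_open[OF E V(1)]] smooth_fun_const
          holomorphic_imp_smooth_section frame_holomorphic[OF E V(1)]) auto
  qed (use V frame_open[OF E V(1)] frame_expansion[OF E V u] in auto)
qed

lemma morphism_frame_expansion:
  assumes V: "holomorphic_bundle A V" and f: "holomorphic_morphism A V W f"
    and frame: "(N, r, e) \<in> frames V" and s: "smooth_section A V U s" and x: "x \<in> U \<inter> N"
  shows "f x (s x) = (\<Sum>i<r. frame_coord r e x (s x) i *\<^sub>C f x (e i x))"
proof -
  have "s x = (\<Sum>i<r. frame_coord r e x (s x) i *\<^sub>C e i x)"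
    using frame_expansion[OF V frame _ smooth_section_in_fiber[OF s]] x by simp
  moreover have "f x (\<Sum>i<r. frame_coord r e x (s x) i *\<^sub>C e i x)
      = (\<Sum>i<r. frame_coord r e x (s x) i *\<^sub>C f x (e i x))"
    using f x by (intro clinear_between_sum[OF _ fiber_subspace[OF V]])
      (auto simp: holomorphic_morphism_def intro: frame_in_fiber[OF V frame])
  ultimately show ?thesis by simp
qed

text \<open>A holomorphic morphism is only required to preserve holomorphic sections; expanding a smooth
  section in a holomorphic frame shows that it preserves smooth ones too.\<close>

lemma holomorphic_morphism_smooth_section:
  assumes V: "holomorphic_bundle A V" and W: "holomorphic_bundle A W"
    and f: "holomorphic_morphism A V W f" and U: "open U" and s: "smooth_section A V U s"
  shows "smooth_section A W U (\<lambda>x. f x (s x))"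
proof (rule smooth_section_local[OF W])
  fix x assume x: "x \<in> U"
  obtain N r e where frame: "(N, r, e) \<in> frames V" "x \<in> N" using frame_obtain[OF V] .
  have N: "open N" using frame_open[OF V frame(1)] .
  then have UN: "open (U \<inter> N)" using U by blast
  have fe: "smooth_section A W N (\<lambda>y. f y (e i y))" if "i < r" for i
    using f frame_holomorphic[OF V frame(1) that] N holomorphic_imp_smooth_section
    unfolding holomorphic_morphism_def by blast
  have "smooth_section A W (U \<inter> N) (\<lambda>x. \<Sum>i<r. frame_coord r e x (s x) i *\<^sub>C f x (e i x))"
    by (rule smooth_section_combination[OF W UN])
      (auto intro: smooth_section_coord[OF s frame(1)] smooth_section_subset[OF fe])
  then have "smooth_section A W (U \<inter> N) (\<lambda>x. f x (s x))"
    by (rule smooth_section_cong[OF W _ UN])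
      (simp add: morphism_frame_expansion[OF V f frame(1) s])
  then show "\<exists>W'. open W' \<and> x \<in> W' \<and> smooth_section A W W' (\<lambda>x. f x (s x))"
    using UN x frame(2) by blast
qed


section \<open>Connections\<close>

lemma
  assumes D: "is_connection A E D" and U: "open U" "x \<in> U"
    and s: "smooth_section A E U s" and v: "v \<in> tangent A x"
  shows connection_in_fiber: "D s x v \<in> fiber E x"
    and connection_add_vector:
      "w \<in> tangent A x \<Longrightarrow> D s x (\<lambda>f. v f + w f) = D s x v + D s x w"
    and connection_add: "smooth_section A E U t \<Longrightarrow> D (\<lambda>y. s y + t y) x v = D s x v + D t x v"
    and connection_Leibniz:
      "smooth_fun A U f \<Longrightarrow> D (\<lambda>y. f y *\<^sub>C s y) x v = v f *\<^sub>C s x + f x *\<^sub>C D s x v"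
    and connection_cong:
      "smooth_section A E U t \<Longrightarrow> (\<And>y. y \<in> U \<Longrightarrow> s y = t y) \<Longrightarrow> D s x v = D t x v"
proof -
  note D = D[unfolded is_connection_def]
  note 1 = D[THEN conjunct1, THEN spec[of _ U], THEN spec[of _ s], THEN mp, OF conjI[OF U(1) s]]
  show "D s x v \<in> fiber E x"
    using 1[THEN conjunct1] U(2) v by blast
  show "D s x (\<lambda>f. v f + w f) = D s x v + D s x w" if "w \<in> tangent A x"
    using 1[THEN conjunct2, THEN conjunct1] U(2) v that by blast
  show "D (\<lambda>y. s y + t y) x v = D s x v + D t x v" if "smooth_section A E U t"
    using D[THEN conjunct2, THEN conjunct1, THEN spec[of _ U], THEN spec[of _ s],
        THEN spec[of _ t]] U s v that by blast
  show "D (\<lambda>y. f y *\<^sub>C s y) x v = v f *\<^sub>C s x + f x *\<^sub>C D s x v" if "smooth_fun A U f"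
    using D[THEN conjunct2, THEN conjunct2, THEN conjunct1, THEN spec[of _ U], THEN spec[of _ f],
        THEN spec[of _ s]] U s v that by blast
  show "D s x v = D t x v" if "smooth_section A E U t" "\<And>y. y \<in> U \<Longrightarrow> s y = t y"
    using D[THEN conjunct2, THEN conjunct2, THEN conjunct2, THEN spec[of _ U], THEN spec[of _ s],
        THEN spec[of _ t]] U s v that by blast
qed

lemma connection_smooth_section:
  assumes D: "is_connection A E D" and U: "open U" and s: "smooth_section A E U s"
    and \<xi>: "smooth_field A U \<xi>"
  shows "smooth_section A E U (\<lambda>x. D s x (\<xi> x))"
  using D[unfolded is_connection_def, THEN conjunct1, THEN spec[of _ U], THEN spec[of _ s],
      THEN mp, OF conjI[OF U s]] \<xi> by blast

lemma connection_combination: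
  assumes E: "holomorphic_bundle A E" and D: "is_connection A E D" and U: "open U" "x \<in> U"
    and v: "v \<in> tangent A x" and I: "finite I"
    and f: "\<And>i. i \<in> I \<Longrightarrow> smooth_fun A U (f i)"
    and s: "\<And>i. i \<in> I \<Longrightarrow> smooth_section A E U (s i)"
  shows "D (\<lambda>y. \<Sum>i\<in>I. f i y *\<^sub>C s i y) x v
    = (\<Sum>i\<in>I. v (f i) *\<^sub>C s i x + f i x *\<^sub>C D (s i) x v)"
  using I f s
proof (induction I rule: finite_induct)
  case empty
  have zero: "smooth_section A E U (\<lambda>x. 0)"
    using smooth_section_combination[OF E U(1), of "{}"] by simp
  show ?case using connection_add[OF D U zero v zero] by simp
next
  case (insert i I)
  have "D (\<lambda>y. f i y *\<^sub>C s i y + (\<Sum>i\<in>I. f i y *\<^sub>C s i y)) x v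
    = D (\<lambda>y. f i y *\<^sub>C s i y) x v + D (\<lambda>y. \<Sum>i\<in>I. f i y *\<^sub>C s i y) x v"
    using insert U by (intro connection_add[OF D U _ v] smooth_section_scale[OF E]
        smooth_section_combination[OF E]) auto
  then show ?case
    using insert connection_Leibniz[OF D U _ v] by simp
qed

text \<open>With \<open>f\<close> the identity, this expresses a connection through its values on a frame.\<close>

lemma connection_morphism_frame:
  assumes V: "holomorphic_bundle A V" and W: "holomorphic_bundle A W"
    and f: "holomorphic_morphism A V W f" and D: "is_connection A W D"
    and frame: "(N, r, e) \<in> frames V" and U: "open U" and s: "smooth_section A V U s"
    and x: "x \<in> U \<inter> N" and v: "v \<in> tangent A x"
  shows "D (\<lambda>y. f y (s y)) x v = (\<Sum>i<r. v (\<lambda>y. frame_coord r e y (s y) i) *\<^sub>C f x (e i x)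
    + frame_coord r e x (s x) i *\<^sub>C D (\<lambda>y. f y (e i y)) x v)"
proof -
  have N: "open N" using frame_open[OF V frame] .
  then have UN: "open (U \<inter> N)" using U by blast
  have fe: "smooth_section A W (U \<inter> N) (\<lambda>y. f y (e i y))" if "i < r" for i
    by (rule smooth_section_subset[OF holomorphic_morphism_smooth_section[OF V W f N
            holomorphic_imp_smooth_section[OF frame_holomorphic[OF V frame that]]]]) simp
  have c: "smooth_fun A (U \<inter> N) (\<lambda>y. frame_coord r e y (s y) i)" if "i < r" for i
    by (rule smooth_section_coord[OF s frame that])
  have "D (\<lambda>y. f y (s y)) x v
      = D (\<lambda>y. \<Sum>i<r. frame_coord r e y (s y) i *\<^sub>C f y (e i y)) x v"
  proof (rule connection_cong[OF D UN x _ v _ morphism_frame_expansion[OF V f frame s]])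
    show "smooth_section A W (U \<inter> N) (\<lambda>y. f y (s y))"
      by (rule smooth_section_subset[OF holomorphic_morphism_smooth_section[OF V W f U s]]) simp
    show "smooth_section A W (U \<inter> N) (\<lambda>y. \<Sum>i<r. frame_coord r e y (s y) i *\<^sub>C f y (e i y))"
      by (rule smooth_section_combination[OF W UN]) (auto intro: c fe)
  qed
  also have "\<dots> = (\<Sum>i<r. v (\<lambda>y. frame_coord r e y (s y) i) *\<^sub>C f x (e i x)
    + frame_coord r e x (s x) i *\<^sub>C D (\<lambda>y. f y (e i y)) x v)"
    by (rule connection_combination[OF W D UN x v]) (auto intro: c fe)
  finally show ?thesis .
qed

lemma holomorphic_morphism_id: "holomorphic_morphism A V V (\<lambda>x u. u)"
  unfolding holomorphic_morphism_def clinear_between_def by auto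

lemma chern_connection_imp_connection: "chern_connection A E b D \<Longrightarrow> is_connection A E D"
  unfolding chern_connection_def by blast

lemma chern_connection_metric:
  assumes D: "chern_connection A E b D" and U: "open U" "x \<in> U"
    and s: "smooth_section A E U s" and t: "smooth_section A E U t" and v: "v \<in> tangent A x"
  shows "v (\<lambda>y. b y (s y) (t y)) = b x (D s x v) (t x) + b x (s x) (D t x (conj_tvec v))"
  using D[unfolded chern_connection_def, THEN conjunct2, THEN conjunct1, THEN spec[of _ U],
      THEN spec[of _ s], THEN spec[of _ t]] U s t v by blast

lemma chern_connection_holomorphic:
  assumes E: "holomorphic_bundle A E" and D: "chern_connection A E b D" and U: "open U" "x \<in> U"
    and s: "holomorphic_section A E U s" and v: "v \<in> tangent01 A x"
  shows "D s x v = 0"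
proof -
  obtain V r e where V: "(V, r, e) \<in> frames E" "x \<in> V" using frame_obtain[OF E] .
  have "D s x v = dbar_in_frame r e s x v"
    using D[unfolded chern_connection_def, THEN conjunct2, THEN conjunct2, THEN spec[of _ U],
        THEN spec[of _ s]] U V v holomorphic_imp_smooth_section[OF s] by fast
  moreover have "v (\<lambda>y. frame_coord r e y (s y) i) = 0" if "i < r" for i
  proof (rule tangent01_holomorphic[OF v])
    show "holomorphic_fun A (U \<inter> V) (\<lambda>y. frame_coord r e y (s y) i)"
      using s V(1) that unfolding holomorphic_section_def by blast
  qed (use U V in blast)
  ultimately show ?thesis by (simp add: dbar_in_frame_def)
qed

text \<open>A Chern connection annihilates holomorphic sections in direction \<open>(0,1)\<close>. In a holomorphic
  frame, both sides therefore reduce to the derivatives of the coefficients of \<open>s\<close>, multiplied by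
  the images of the frame sections.\<close>

lemma holomorphic_morphism_commutes_dbar:
  assumes V: "holomorphic_bundle A V" and W: "holomorphic_bundle A W"
    and f: "holomorphic_morphism A V W f"
    and DV: "chern_connection A V bV DV" and DW: "chern_connection A W bW DW"
    and U: "open U" "x \<in> U" and s: "smooth_section A V U s" and v: "v \<in> tangent01 A x"
  shows "DW (\<lambda>y. f y (s y)) x v = f x (DV s x v)"
proof -
  obtain N r e where frame: "(N, r, e) \<in> frames V" "x \<in> N" using frame_obtain[OF V] .
  have N: "open N" using frame_open[OF V frame(1)] .
  have x: "x \<in> U \<inter> N" using U frame by blast
  have v': "v \<in> tangent A x" using v tangent01_subset by blast
  have "DV (e i) x v = 0" if "i < r" for i
    using chern_connection_holomorphic[OF V DV N frame(2) frame_holomorphic[OF V frame(1) that] v] .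
  then have "DV s x v = (\<Sum>i<r. v (\<lambda>y. frame_coord r e y (s y) i) *\<^sub>C e i x)"
    using connection_morphism_frame[OF V V holomorphic_morphism_id
        chern_connection_imp_connection[OF DV] frame(1) U(1) s x v'] by simp
  moreover have fx: "clinear_between (fiber V x) (fiber W x) (f x)"
    using f unfolding holomorphic_morphism_def by blast
  ultimately have "f x (DV s x v) = (\<Sum>i<r. v (\<lambda>y. frame_coord r e y (s y) i) *\<^sub>C f x (e i x))"
    using clinear_between_sum[OF fx fiber_subspace[OF V], where v = "\<lambda>i. e i x" and I = "{..<r}"]
      frame_in_fiber[OF V frame] by simp
  moreover have "DW (\<lambda>y. f y (e i y)) x v = 0" if "i < r" for i
    using chern_connection_holomorphic[OF W DW N frame(2) _ v] f N
      frame_holomorphic[OF V frame(1) that]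
    unfolding holomorphic_morphism_def by blast
  ultimately show ?thesis
    using connection_morphism_frame[OF V W f chern_connection_imp_connection[OF DW] frame(1) U(1)
        s x v'] by simp
qed

text \<open>The terms that contain derivatives of the coefficients of \<open>s\<close> in a frame cancel, so that
  \<open>D\<^sub>E (j s) - j (D\<^sub>S s)\<close> depends on the value of \<open>s\<close> at the point only.\<close>

lemma second_fundamental_form_eq:
  assumes S: "holomorphic_bundle A S" and E: "holomorphic_bundle A E"
    and j: "holomorphic_morphism A S E j"
    and DS: "is_connection A S DS" and DE: "is_connection A E DE"
    and U: "open U" "x \<in> U" and s: "smooth_section A S U s" and v: "v \<in> tangent A x"
  shows "second_fundamental_form A S j q DS DE x v (s x) = q x (DE (\<lambda>y. j y (s y)) x v - j x (DS s x v))"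
proof -
  obtain N r e where frame: "(N, r, e) \<in> frames S" "x \<in> N" using frame_obtain[OF S] .
  have N: "open N" using frame_open[OF S frame(1)] .
  have tensorial: "DE (\<lambda>y. j y (t y)) x v - j x (DS t x v)
      = (\<Sum>i<r. frame_coord r e x (t x) i *\<^sub>C (DE (\<lambda>y. j y (e i y)) x v - j x (DS (e i) x v)))"
    if "open U" "x \<in> U" and t: "smooth_section A S U t" for U t
  proof -
    have x: "x \<in> U \<inter> N" using that frame by blast
    let ?c = "\<lambda>i. frame_coord r e x (t x) i" and ?v = "\<lambda>i. v (\<lambda>y. frame_coord r e y (t y) i)"
    have De: "DS (e i) x v \<in> fiber S x" if "i < r" for i
      using connection_in_fiber[OF DS N frame(2) holomorphic_imp_smooth_section[OF
            frame_holomorphic[OF S frame(1) that]] v] .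
    have jx: "clinear_between (fiber S x) (fiber E x) (j x)"
      using j unfolding holomorphic_morphism_def by blast
    have "j x (DS t x v) = j x ((\<Sum>i<r. ?v i *\<^sub>C e i x + ?c i *\<^sub>C DS (e i) x v))"
      using connection_morphism_frame[OF S S holomorphic_morphism_id DS frame(1) that(1) t x v]
      by simp
    also have "\<dots> = j x ((\<Sum>i<r. ?v i *\<^sub>C e i x) + (\<Sum>i<r. ?c i *\<^sub>C DS (e i) x v))"
      by (simp add: sum.distrib)
    also have "\<dots> = j x (\<Sum>i<r. ?v i *\<^sub>C e i x) + j x (\<Sum>i<r. ?c i *\<^sub>C DS (e i) x v)"
    proof -
      have "(\<Sum>i<r. ?v i *\<^sub>C e i x) \<in> fiber S x" "(\<Sum>i<r. ?c i *\<^sub>C DS (e i) x v) \<in> fiber S x"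
        using De frame_in_fiber[OF S frame]
        by (auto intro!: complex_vector.subspace_sum complex_vector.subspace_scale fiber_subspace[OF S])
      then show ?thesis using jx unfolding clinear_between_def by blast
    qed
    also have "\<dots> = (\<Sum>i<r. ?v i *\<^sub>C j x (e i x)) + (\<Sum>i<r. ?c i *\<^sub>C j x (DS (e i) x v))"
      using clinear_between_sum[OF jx fiber_subspace[OF S], where v = "\<lambda>i. e i x" and I = "{..<r}"]
        clinear_between_sum[OF jx fiber_subspace[OF S],
          where v = "\<lambda>i. DS (e i) x v" and I = "{..<r}"]
        De frame_in_fiber[OF S frame] by simp
    finally show ?thesis
      using connection_morphism_frame[OF S E j DE frame(1) that(1) t x v]
      by (simp add: sum.distrib complex_vector.scale_right_diff_distrib sum_subtractf)
  qed
  show ?thesis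
    unfolding second_fundamental_form_def
  proof (rule the_equality)
    show "\<forall>U' t. open U' \<and> x \<in> U' \<and> smooth_section A S U' t \<and> t x = s x \<longrightarrow>
      q x (DE (\<lambda>y. j y (s y)) x v - j x (DS s x v)) = q x (DE (\<lambda>y. j y (t y)) x v - j x (DS t x v))"
      using tensorial[OF _ _ s] tensorial U by auto
  qed (use U s in blast)
qed

end


section \<open>Curvature of compatible connections\<close>

text \<open>Additivity and Hermitian symmetry: the fiberwise algebra that goes with metric compatibility.\<close>

definition hermitian_on :: "'v::complex_vector set \<Rightarrow> ('v \<Rightarrow> 'v \<Rightarrow> complex) \<Rightarrow> bool"
  where "hermitian_on V b \<longleftrightarrow> complex_vector.subspace V \<and>
    (\<forall>u\<in>V. \<forall>v\<in>V. \<forall>w\<in>V. b (u + v) w = b u w + b v w) \<and>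
    (\<forall>u\<in>V. \<forall>w\<in>V. b w u = cnj (b u w))"

lemma hermitian_on_sym: "hermitian_on V b \<Longrightarrow> u \<in> V \<Longrightarrow> v \<in> V \<Longrightarrow> b v u = cnj (b u v)"
  unfolding hermitian_on_def by blast

lemma hermitian_on_add_left:
  "hermitian_on V b \<Longrightarrow> u \<in> V \<Longrightarrow> v \<in> V \<Longrightarrow> w \<in> V \<Longrightarrow> b (u + v) w = b u w + b v w"
  unfolding hermitian_on_def by blast

lemma hermitian_on_add_right:
  assumes b: "hermitian_on V b" and "u \<in> V" "v \<in> V" "w \<in> V"
  shows "b w (u + v) = b w u + b w v"
proof -
  have "u + v \<in> V" using assms complex_vector.subspace_add unfolding hermitian_on_def by blast
  then show ?thesis
    using assms hermitian_on_sym[OF b, of w] hermitian_on_sym[OF b, of "u + v" w]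
    by (simp add: hermitian_on_add_left[OF b] hermitian_on_sym[OF b, of _ w])
qed

lemma hermitian_on_diff_left:
  assumes b: "hermitian_on V b" and V: "u \<in> V" "v \<in> V" "w \<in> V"
  shows "b (u - v) w = b u w - b v w"
proof -
  have "u - v \<in> V" using b V complex_vector.subspace_diff unfolding hermitian_on_def by blast
  then have "b (u - v + v) w = b (u - v) w + b v w" using hermitian_on_add_left[OF b _ V(2,3)] by blast
  then show ?thesis by simp
qed

lemma hermitian_on_diff_right:
  assumes b: "hermitian_on V b" and V: "u \<in> V" "v \<in> V" "w \<in> V"
  shows "b w (u - v) = b w u - b w v"
proof -
  have "u - v \<in> V" using b V complex_vector.subspace_diff unfolding hermitian_on_def by blast
  then have "b w (u - v + v) = b w (u - v) + b w v" using hermitian_on_add_right[OF b _ V(2,3)] by blast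
  then show ?thesis by simp
qed

lemma hermitian_on_zero: "hermitian_on V b \<Longrightarrow> w \<in> V \<Longrightarrow> b 0 w = 0"
  using hermitian_on_diff_left[of V b w w w] by simp

context atlas
begin

lemma smooth_field10_imp_smooth_field: "smooth_field10 A U \<xi> \<Longrightarrow> smooth_field A U \<xi>"
  unfolding smooth_field10_def by blast

lemma smooth_field10_in_tangent10: "smooth_field10 A U \<xi> \<Longrightarrow> x \<in> U \<Longrightarrow> \<xi> x \<in> tangent10 A x"
  unfolding smooth_field10_def by blast

lemma smooth_field_in_tangent: "smooth_field A U \<xi> \<Longrightarrow> x \<in> U \<Longrightarrow> \<xi> x \<in> tangent A x"
  unfolding smooth_field_def by blast

text \<open>Metric compatibility moves the outer derivatives of \<open>D\<^sup>2 s\<close> off the first argument. What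
  remains are the functions \<open>b (D\<^sub>\<xi> s, t)\<close> and pairings of first derivatives.\<close>

lemma curvature_tensor_metric:
  assumes V: "holomorphic_bundle A V" and b: "hermitian_on (fiber V x) (b x)"
    and D: "chern_connection A V b D" and U: "open U" "x \<in> U"
    and \<alpha>: "smooth_field10 A U \<alpha>" and \<beta>: "smooth_field10 A U \<beta>"
    and s: "smooth_section A V U s" and t: "smooth_section A V U t"
  defines "\<gamma> \<equiv> \<lambda>y. conj_tvec (\<beta> y)"
  shows "curvature_tensor A b D \<alpha> \<beta> s t x =
    \<alpha> x (\<lambda>y. b y (D s y (\<gamma> y)) (t y)) - \<gamma> x (\<lambda>y. b y (D s y (\<alpha> y)) (t y))
    - b x (D s x (lie_bracket A \<alpha> \<gamma> x)) (t x)
    + b x (D s x (\<alpha> x)) (D t x (\<beta> x))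
    - b x (D s x (\<gamma> x)) (D t x (conj_tvec (\<alpha> x)))"
proof -
  note conn = chern_connection_imp_connection[OF D]
  have \<alpha>': "smooth_field A U \<alpha>" and \<gamma>: "smooth_field A U \<gamma>"
    using smooth_field10_imp_smooth_field[OF \<alpha>]
      smooth_field_conj[OF smooth_field10_imp_smooth_field[OF \<beta>]] unfolding \<gamma>_def by auto
  have tan: "\<alpha> x \<in> tangent A x" "\<gamma> x \<in> tangent A x" "lie_bracket A \<alpha> \<gamma> x \<in> tangent A x"
    using smooth_field_in_tangent[OF \<alpha>' U(2)] smooth_field_in_tangent[OF \<gamma> U(2)]
      lie_bracket_tangent[OF \<alpha>' \<gamma> U] by auto
  have D\<gamma>: "smooth_section A V U (\<lambda>y. D s y (\<gamma> y))" and D\<alpha>: "smooth_section A V U (\<lambda>y. D s y (\<alpha> y))"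
    using connection_smooth_section[OF conn U(1) s] \<alpha>' \<gamma> by blast+
  have fib: "D (\<lambda>y. D s y (\<gamma> y)) x (\<alpha> x) \<in> fiber V x" "D (\<lambda>y. D s y (\<alpha> y)) x (\<gamma> x) \<in> fiber V x"
    "D s x (lie_bracket A \<alpha> \<gamma> x) \<in> fiber V x" "t x \<in> fiber V x"
    using connection_in_fiber[OF conn U] D\<gamma> D\<alpha> s tan smooth_section_in_fiber[OF t U(2)] by blast+
  have "curvature_tensor A b D \<alpha> \<beta> s t x = b x (D (\<lambda>y. D s y (\<gamma> y)) x (\<alpha> x)) (t x)
      - b x (D (\<lambda>y. D s y (\<alpha> y)) x (\<gamma> x)) (t x) - b x (D s x (lie_bracket A \<alpha> \<gamma> x)) (t x)"
    using fib complex_vector.subspace_diff[OF fiber_subspace[OF V]]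
    unfolding curvature_tensor_def ext_cov_deriv_def \<gamma>_def[symmetric]
    by (simp add: hermitian_on_diff_left[OF b])
  moreover have "\<alpha> x (\<lambda>y. b y (D s y (\<gamma> y)) (t y)) = b x (D (\<lambda>y. D s y (\<gamma> y)) x (\<alpha> x)) (t x)
      + b x (D s x (\<gamma> x)) (D t x (conj_tvec (\<alpha> x)))"
    using chern_connection_metric[OF D U D\<gamma> t tan(1)] .
  moreover have "\<gamma> x (\<lambda>y. b y (D s y (\<alpha> y)) (t y)) = b x (D (\<lambda>y. D s y (\<alpha> y)) x (\<gamma> x)) (t x)
      + b x (D s x (\<alpha> x)) (D t x (\<beta> x))"
    using chern_connection_metric[OF D U D\<alpha> t tan(2)]
    unfolding \<gamma>_def conj_tvec_conj_tvec .
  ultimately show ?thesis by simp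
qed

text \<open>Two bundles whose functions \<open>b (D\<^sub>\<xi> s, t)\<close> coincide have curvature tensors that differ by
  pairings of first derivatives only. Both curvature formulas are instances.\<close>

lemma curvature_tensor_difference:
  assumes V: "holomorphic_bundle A V" "\<And>x. hermitian_on (fiber V x) (b x)"
      "chern_connection A V b D" "smooth_section A V U s" "smooth_section A V U t"
    and W: "holomorphic_bundle A W" "\<And>x. hermitian_on (fiber W x) (b' x)"
      "chern_connection A W b' D'" "smooth_section A W U s'" "smooth_section A W U t'"
    and U: "open U" "x \<in> U"
    and \<alpha>: "smooth_field10 A U \<alpha>" and \<beta>: "smooth_field10 A U \<beta>"
    and eq: "\<And>y v. y \<in> U \<Longrightarrow> v \<in> tangent A y \<Longrightarrow> b' y (D' s' y v) (t' y) = b y (D s y v) (t y)"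
  shows "curvature_tensor A b' D' \<alpha> \<beta> s' t' x - curvature_tensor A b D \<alpha> \<beta> s t x =
    (b' x (D' s' x (\<alpha> x)) (D' t' x (\<beta> x)) - b x (D s x (\<alpha> x)) (D t x (\<beta> x)))
    - (b' x (D' s' x (conj_tvec (\<beta> x))) (D' t' x (conj_tvec (\<alpha> x)))
       - b x (D s x (conj_tvec (\<beta> x))) (D t x (conj_tvec (\<alpha> x))))"
proof -
  let ?\<gamma> = "\<lambda>y. conj_tvec (\<beta> y)"
  have \<alpha>': "smooth_field A U \<alpha>" and \<gamma>: "smooth_field A U ?\<gamma>"
    using smooth_field10_imp_smooth_field[OF \<alpha>]
      smooth_field_conj[OF smooth_field10_imp_smooth_field[OF \<beta>]] by auto
  have "\<alpha> x (\<lambda>y. b' y (D' s' y (?\<gamma> y)) (t' y)) = \<alpha> x (\<lambda>y. b y (D s y (?\<gamma> y)) (t y))"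
    by (rule tangent_local[OF smooth_field_in_tangent[OF \<alpha>' U(2)] U])
      (use eq smooth_field_in_tangent[OF \<gamma>] in blast)
  moreover have "?\<gamma> x (\<lambda>y. b' y (D' s' y (\<alpha> y)) (t' y)) = ?\<gamma> x (\<lambda>y. b y (D s y (\<alpha> y)) (t y))"
    by (rule tangent_local[OF smooth_field_in_tangent[OF \<gamma> U(2)] U])
      (use eq smooth_field_in_tangent[OF \<alpha>'] in blast)
  moreover have "b' x (D' s' x (lie_bracket A \<alpha> ?\<gamma> x)) (t' x) = b x (D s x (lie_bracket A \<alpha> ?\<gamma> x)) (t x)"
    using eq[OF U(2) lie_bracket_tangent[OF \<alpha>' \<gamma> U]] .
  ultimately show ?thesis
    unfolding curvature_tensor_metric[OF V(1-3) U \<alpha> \<beta> V(4,5)]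
      curvature_tensor_metric[OF W(1-3) U \<alpha> \<beta> W(4,5)]
    by simp
qed

text \<open>Connections are additive in the direction, so that identities between the functions
  \<open>b (D\<^sub>\<xi> s, t)\<close> may be checked on \<open>(1,0)\<close>- and \<open>(0,1)\<close>-vectors.\<close>

lemma connection_pairing_eq_on_tangent:
  assumes V: "hermitian_on (fiber V x) (b x)" "is_connection A V D" "smooth_section A V U s"
      "u \<in> fiber V x"
    and W: "hermitian_on (fiber W x) (b' x)" "is_connection A W D'" "smooth_section A W U s'"
      "u' \<in> fiber W x"
    and U: "open U" "x \<in> U"
    and eq: "\<And>v. v \<in> tangent10 A x \<Longrightarrow> b' x (D' s' x v) u' = b x (D s x v) u"
      "\<And>v. v \<in> tangent01 A x \<Longrightarrow> b' x (D' s' x v) u' = b x (D s x v) u"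
    and v: "v \<in> tangent A x"
  shows "b' x (D' s' x v) u' = b x (D s x v) u"
proof -
  obtain v' v'' where v': "v' \<in> tangent10 A x" "v'' \<in> tangent01 A x" "v = (\<lambda>f. v' f + v'' f)"
    using tangent_decomposition[OF v] .
  then have tan: "v' \<in> tangent A x" "v'' \<in> tangent A x"
    using tangent10_subset tangent01_subset by blast+
  show ?thesis
    unfolding v'(3)
    using V W eq v' tan connection_in_fiber[OF V(2) U V(3)] connection_in_fiber[OF W(2) U W(3)]
      connection_add_vector[OF V(2) U V(3) tan] connection_add_vector[OF W(2) U W(3) tan]
    by (simp add: hermitian_on_add_left[OF V(1)] hermitian_on_add_left[OF W(1)])
qed

end


section \<open>Short exact sequences with induced forms\<close>

locale hermitian_exact_sequence = atlas A
  for A :: "('x::t2_space, 'n::finite) chart set" +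
  fixes S :: "('x, 's::complex_vector) vbundle"
    and E :: "('x, 'e::complex_vector) vbundle"
    and Q :: "('x, 'q::complex_vector) vbundle"
    and j :: "'x \<Rightarrow> 's \<Rightarrow> 'e" and q :: "'x \<Rightarrow> 'e \<Rightarrow> 'q"
    and bS :: "('x, 's) form" and bE :: "('x, 'e) form" and bQ :: "('x, 'q) form"
    and DS :: "('x \<Rightarrow> 's) \<Rightarrow> ('x, 's) vform1"
    and DE :: "('x \<Rightarrow> 'e) \<Rightarrow> ('x, 'e) vform1"
    and DQ :: "('x \<Rightarrow> 'q) \<Rightarrow> ('x, 'q) vform1"
  assumes bundle_S: "holomorphic_bundle A S" and bundle_E: "holomorphic_bundle A E"
    and bundle_Q: "holomorphic_bundle A Q"
    and exact: "short_exact_sequence A S E Q j q"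
    and form_E: "smooth_hermitian_form A E bE"
    and perp_sum: "\<And>x. {u + v | u v. u \<in> j x ` fiber S x \<and> v \<in> sub_perp S E j bE x} = fiber E x"
    and perp_inter: "\<And>x. j x ` fiber S x \<inter> sub_perp S E j bE x = j x ` fiber S x \<inter> form_kernel E bE x"
    and bS_eq: "bS = pullback_form j bE" and bQ_eq: "bQ = quotient_form S E j q bE"
    and chern_S: "chern_connection A S bS DS" and chern_E: "chern_connection A E bE DE"
    and chern_Q: "chern_connection A Q bQ DQ"
begin

abbreviation perp :: "'x \<Rightarrow> 'e set"
  where "perp x \<equiv> sub_perp S E j bE x"

abbreviation sff :: "('x, 's, 'q) hom_form1"
  where "sff \<equiv> second_fundamental_form A S j q DS DE"

lemmas j_holomorphic = exact[unfolded short_exact_sequence_def, THEN conjunct1]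
  and q_holomorphic = exact[unfolded short_exact_sequence_def, THEN conjunct2, THEN conjunct1]
  and fiber_exact =
    exact[unfolded short_exact_sequence_def, THEN conjunct2, THEN conjunct2, THEN spec, THEN conjunct2]

lemma j_clinear: "clinear_between (fiber S x) (fiber E x) (j x)"
  and q_clinear: "clinear_between (fiber E x) (fiber Q x) (q x)"
  using j_holomorphic q_holomorphic unfolding holomorphic_morphism_def by blast+

lemma j_in_fiber: "u \<in> fiber S x \<Longrightarrow> j x u \<in> fiber E x"
  and q_in_fiber: "w \<in> fiber E x \<Longrightarrow> q x w \<in> fiber Q x"
  using j_clinear q_clinear unfolding clinear_between_def by blast+

lemma j_add: "u \<in> fiber S x \<Longrightarrow> v \<in> fiber S x \<Longrightarrow> j x (u + v) = j x u + j x v"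
  and q_add: "u' \<in> fiber E x \<Longrightarrow> v' \<in> fiber E x \<Longrightarrow> q x (u' + v') = q x u' + q x v'"
  using j_clinear[of x] q_clinear[of x] unfolding clinear_between_def by blast+

lemma q_kernel: "w \<in> fiber E x \<Longrightarrow> q x w = 0 \<longleftrightarrow> w \<in> j x ` fiber S x"
  using fiber_exact[of x] by blast

lemma q_j: "u \<in> fiber S x \<Longrightarrow> q x (j x u) = 0"
  using q_kernel j_in_fiber by blast

lemma hermitian_E: "hermitian_on (fiber E x) (bE x)"
  using fiber_subspace[OF bundle_E] form_E[unfolded smooth_hermitian_form_def, THEN conjunct1]
    form_E[unfolded smooth_hermitian_form_def, THEN conjunct2, THEN conjunct2, THEN conjunct1]
  unfolding hermitian_on_def by blast

lemma bS_apply: "bS x u v = bE x (j x u) (j x v)"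
  by (simp add: bS_eq pullback_form_def)

lemma hermitian_S: "hermitian_on (fiber S x) (bS x)"
  unfolding hermitian_on_def bS_apply
proof (intro conjI ballI)
  show "complex_vector.subspace (fiber S x)" by (rule fiber_subspace[OF bundle_S])
  fix u v assume u: "u \<in> fiber S x" and v: "v \<in> fiber S x"
  show "bE x (j x v) (j x u) = cnj (bE x (j x u) (j x v))"
    by (rule hermitian_on_sym[OF hermitian_E u[THEN j_in_fiber] v[THEN j_in_fiber]])
  show "bE x (j x (u + v)) (j x w) = bE x (j x u) (j x w) + bE x (j x v) (j x w)"
    if "w \<in> fiber S x" for w
    unfolding j_add[OF u v] using u v that
    by (intro hermitian_on_add_left[OF hermitian_E] j_in_fiber)
qed

lemma perp_in_fiber: "w \<in> perp x \<Longrightarrow> w \<in> fiber E x"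
  unfolding sub_perp_def by blast

lemma perp_pairing_left: "w \<in> perp x \<Longrightarrow> u \<in> fiber S x \<Longrightarrow> bE x w (j x u) = 0"
  unfolding sub_perp_def by blast

lemma perp_pairing_right:
  assumes "w \<in> perp x" "u \<in> fiber S x"
  shows "bE x (j x u) w = 0"
  using hermitian_on_sym[OF hermitian_E perp_in_fiber[OF assms(1)] j_in_fiber[OF assms(2)]]
    perp_pairing_left[OF assms] by simp

lemma fiber_decomposition:
  assumes "w \<in> fiber E x"
  obtains u w' where "u \<in> fiber S x" "w' \<in> perp x" "w = j x u + w'"
proof -
  have "w \<in> {u + v | u v. u \<in> j x ` fiber S x \<and> v \<in> perp x}" using assms perp_sum by simp
  then show ?thesis using that by blast
qed

lemma perp_lift:
  assumes "u \<in> fiber Q x"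
  obtains w where "w \<in> perp x" "q x w = u"
proof -
  have "u \<in> q x ` fiber E x" using fiber_exact[of x] assms by simp
  then obtain w where w: "w \<in> fiber E x" "q x w = u" by blast
  obtain v w' where v: "v \<in> fiber S x" "w' \<in> perp x" "w = j x v + w'"
    using fiber_decomposition[OF w(1)] .
  have "q x w = q x w'"
    unfolding v(3) using v(1,2) by (simp add: q_add j_in_fiber perp_in_fiber q_j)
  then show ?thesis using that v(2) w(2) by simp
qed

lemma perp_diff: "v \<in> perp x \<Longrightarrow> w \<in> perp x \<Longrightarrow> v - w \<in> perp x"
  unfolding sub_perp_def
  by (simp add: hermitian_on_diff_left[OF hermitian_E] j_in_fiber
      complex_vector.subspace_diff[OF fiber_subspace[OF bundle_E]])

lemma perp_add: "v \<in> perp x \<Longrightarrow> w \<in> perp x \<Longrightarrow> v + w \<in> perp x"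
  unfolding sub_perp_def
  by (simp add: hermitian_on_add_left[OF hermitian_E] j_in_fiber
      complex_vector.subspace_add[OF fiber_subspace[OF bundle_E]])

text \<open>Two lifts to \<open>S\<^sup>\<bottom>\<close> of the same element of \<open>Q\<close> differ by an element of
  \<open>S \<inter> S\<^sup>\<bottom>\<close>, which is contained in the kernel of \<open>b\<^sub>E\<close>.\<close>

lemma perp_lift_unique:
  assumes "v \<in> perp x" "w \<in> perp x" "q x v = q x w" "y \<in> fiber E x"
  shows "bE x v y = bE x w y"
proof -
  note vw = perp_in_fiber[OF assms(1)] perp_in_fiber[OF assms(2)]
  have "q x (v - w) = 0"
    using clinear_between_diff[OF q_clinear fiber_subspace[OF bundle_E] vw] assms(3) by simp
  then have "v - w \<in> j x ` fiber S x"
    using q_kernel complex_vector.subspace_diff[OF fiber_subspace[OF bundle_E] vw] by blast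
  then have "v - w \<in> form_kernel E bE x" using perp_inter perp_diff assms(1,2) by blast
  then have "bE x (v - w) y = 0" using assms(4) unfolding form_kernel_def by blast
  then show ?thesis by (simp add: hermitian_on_diff_left[OF hermitian_E vw assms(4)])
qed

lemma bQ_apply:
  assumes "v \<in> perp x" "w \<in> perp x"
  shows "bQ x (q x v) (q x w) = bE x v w"
  unfolding bQ_eq quotient_form_def
proof (rule the_equality)
  have "bE x v w = bE x v' w'"
    if v': "v' \<in> perp x" "q x v' = q x v" and w': "w' \<in> perp x" "q x w' = q x w" for v' w'
  proof -
    note fib = assms[THEN perp_in_fiber] v'(1)[THEN perp_in_fiber] w'(1)[THEN perp_in_fiber]
    have "bE x v w = bE x v' w" using perp_lift_unique[OF v'(1) assms(1) v'(2) fib(2)] by simp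
    also have "\<dots> = cnj (bE x w v')" using hermitian_on_sym[OF hermitian_E fib(2,3)] .
    also have "\<dots> = cnj (bE x w' v')"
      using perp_lift_unique[OF w'(1) assms(2) w'(2) fib(3)] by simp
    also have "\<dots> = bE x v' w'" using hermitian_on_sym[OF hermitian_E fib(4,3)] by simp
    finally show ?thesis .
  qed
  then show "\<forall>v'\<in>perp x. \<forall>w'\<in>perp x. q x v' = q x v \<and> q x w' = q x w \<longrightarrow> bE x v w = bE x v' w'"
    by blast
qed (use assms in blast)

lemma hermitian_Q: "hermitian_on (fiber Q x) (bQ x)"
  unfolding hermitian_on_def
proof (intro conjI ballI)
  show "complex_vector.subspace (fiber Q x)" by (rule fiber_subspace[OF bundle_Q])
  fix u v assume u: "u \<in> fiber Q x" and v: "v \<in> fiber Q x"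
  obtain u' where u': "u' \<in> perp x" "q x u' = u" using perp_lift[OF u] .
  obtain v' where v': "v' \<in> perp x" "q x v' = v" using perp_lift[OF v] .
  show "bQ x v u = cnj (bQ x u v)"
    using bQ_apply[OF u'(1) v'(1)] bQ_apply[OF v'(1) u'(1)]
      hermitian_on_sym[OF hermitian_E perp_in_fiber[OF u'(1)] perp_in_fiber[OF v'(1)]]
    unfolding u'(2) v'(2) by simp
  fix w assume w: "w \<in> fiber Q x"
  obtain w' where w': "w' \<in> perp x" "q x w' = w" using perp_lift[OF w] .
  have "q x (u' + v') = u + v"
    using q_add[OF perp_in_fiber[OF u'(1)] perp_in_fiber[OF v'(1)]] u' v' by simp
  then show "bQ x (u + v) w = bQ x u w + bQ x v w"
    using bQ_apply[OF u'(1) w'(1)] bQ_apply[OF v'(1) w'(1)] bQ_apply[OF perp_add[OF u'(1) v'(1)] w'(1)]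
      hermitian_on_add_left[OF hermitian_E perp_in_fiber[OF u'(1)] perp_in_fiber[OF v'(1)]
        perp_in_fiber[OF w'(1)]]
    unfolding u'(2) v'(2) w'(2) by simp
qed

lemmas connection_S = chern_connection_imp_connection[OF chern_S]
  and connection_E = chern_connection_imp_connection[OF chern_E]
  and connection_Q = chern_connection_imp_connection[OF chern_Q]

lemma j_section: "open U \<Longrightarrow> smooth_section A S U s \<Longrightarrow> smooth_section A E U (\<lambda>y. j y (s y))"
  by (rule holomorphic_morphism_smooth_section[OF bundle_S bundle_E j_holomorphic])

lemma q_section: "open U \<Longrightarrow> smooth_section A E U s \<Longrightarrow> smooth_section A Q U (\<lambda>y. q y (s y))"
  by (rule holomorphic_morphism_smooth_section[OF bundle_E bundle_Q q_holomorphic])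

lemmas j_commutes_dbar =
    holomorphic_morphism_commutes_dbar[OF bundle_S bundle_E j_holomorphic chern_S chern_E]
  and q_commutes_dbar =
    holomorphic_morphism_commutes_dbar[OF bundle_E bundle_Q q_holomorphic chern_E chern_Q]


section \<open>The curvature of the subbundle\<close>

text \<open>The connection \<open>D\<^sub>S\<close> is the part of \<open>D\<^sub>E\<close> tangential to \<open>S\<close>. In direction \<open>(0,1)\<close> this
  holds because \<open>j\<close> is holomorphic; it passes to direction \<open>(1,0)\<close> by metric compatibility.\<close>

lemma pairing_D_j:
  assumes U: "open U" "x \<in> U" and s: "smooth_section A S U s" and t: "smooth_section A S U t"
    and v: "v \<in> tangent A x"
  shows "bE x (DE (\<lambda>y. j y (s y)) x v) (j x (t x)) = bS x (DS s x v) (t x)"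
proof -
  have tx: "t x \<in> fiber S x" using smooth_section_in_fiber[OF t U(2)] .
  have dbar: "bE x (DE (\<lambda>y. j y (s y)) x v) (j x (t x)) = bS x (DS s x v) (t x)"
    if "v \<in> tangent01 A x" for v
    by (simp only: j_commutes_dbar[OF U s that] bS_apply)
  have "bE x (DE (\<lambda>y. j y (s y)) x v) (j x (t x)) = bS x (DS s x v) (t x)"
    if v: "v \<in> tangent10 A x" for v
  proof -
    have v': "v \<in> tangent A x" using v tangent10_subset by blast
    have "bE x (DE (\<lambda>y. j y (s y)) x v) (j x (t x))
        = v (\<lambda>y. bE y (j y (s y)) (j y (t y))) - bE x (j x (s x)) (DE (\<lambda>y. j y (t y)) x (conj_tvec v))"
      using chern_connection_metric[OF chern_E U j_section[OF U(1) s] j_section[OF U(1) t] v'] by simp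
    also have "\<dots> = v (\<lambda>y. bS y (s y) (t y)) - bS x (s x) (DS t x (conj_tvec v))"
      by (simp only: j_commutes_dbar[OF U t conj_tvec_tangent10[OF v]] bS_apply)
    also have "\<dots> = bS x (DS s x v) (t x)"
      using chern_connection_metric[OF chern_S U s t v'] by simp
    finally show ?thesis .
  qed
  from connection_pairing_eq_on_tangent[where b = bS and b' = bE and D = DS and D' = DE and x = x
      and s = s and s' = "\<lambda>y. j y (s y)" and u = "t x" and u' = "j x (t x)", OF hermitian_S
      connection_S s tx hermitian_E connection_E j_section[OF U(1) s] j_in_fiber[OF tx] U this dbar v]
  show ?thesis .
qed

text \<open>Every vector of \<open>S\<close> is the value of a local section, which turns the previous identity into
  orthogonality in the fiber.\<close>

lemma
  assumes U: "open U" "x \<in> U" and s: "smooth_section A S U s" and v: "v \<in> tangent A x"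
  shows D_j_normal_perp: "DE (\<lambda>y. j y (s y)) x v - j x (DS s x v) \<in> perp x"
    and sff_eq: "sff x v (s x) = q x (DE (\<lambda>y. j y (s y)) x v - j x (DS s x v))"
proof -
  have DEj: "DE (\<lambda>y. j y (s y)) x v \<in> fiber E x"
    by (rule connection_in_fiber[OF connection_E U j_section[OF U(1) s] v])
  have DSs: "DS s x v \<in> fiber S x" by (rule connection_in_fiber[OF connection_S U s v])
  have "bE x (DE (\<lambda>y. j y (s y)) x v - j x (DS s x v)) (j x u) = 0" if u: "u \<in> fiber S x" for u
  proof -
    obtain U' t where t: "open U'" "x \<in> U'" "smooth_section A S U' t" "t x = u"
      using section_through[OF bundle_S u] .
    have UU': "open (U \<inter> U')" "x \<in> U \<inter> U'" using U t by auto
    have "bE x (DE (\<lambda>y. j y (s y)) x v) (j x (t x)) = bS x (DS s x v) (t x)"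
      by (rule pairing_D_j[OF UU' _ _ v])
        (auto intro: smooth_section_subset[OF s] smooth_section_subset[OF t(3)])
    then show ?thesis
      using DEj DSs u unfolding t(4) bS_apply
      by (simp add: hermitian_on_diff_left[OF hermitian_E] j_in_fiber)
  qed
  then show "DE (\<lambda>y. j y (s y)) x v - j x (DS s x v) \<in> perp x"
    using complex_vector.subspace_diff[OF fiber_subspace[OF bundle_E] DEj j_in_fiber[OF DSs]]
    unfolding sub_perp_def by blast
  show "sff x v (s x) = q x (DE (\<lambda>y. j y (s y)) x v - j x (DS s x v))"
    by (rule second_fundamental_form_eq[OF bundle_S bundle_E j_holomorphic connection_S
          connection_E U s v])
qed

text \<open>The parts of \<open>D\<^sub>E (j s)\<close> in \<open>S\<close> and in \<open>S\<^sup>\<bottom>\<close> are orthogonal to each other, and \<open>q\<close> preserves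
  the forms on \<open>S\<^sup>\<bottom>\<close>.\<close>

lemma pairing_D_j_D_j:
  assumes U: "open U" "x \<in> U" and s: "smooth_section A S U s" and t: "smooth_section A S U t"
    and v: "v \<in> tangent A x" and w: "w \<in> tangent A x"
  shows "bE x (DE (\<lambda>y. j y (s y)) x v) (DE (\<lambda>y. j y (t y)) x w)
    = bS x (DS s x v) (DS t x w) + bQ x (sff x v (s x)) (sff x w (t x))"
proof -
  define \<tau> \<rho> where "\<tau> = DE (\<lambda>y. j y (s y)) x v - j x (DS s x v)"
    and "\<rho> = DE (\<lambda>y. j y (t y)) x w - j x (DS t x w)"
  have D: "DE (\<lambda>y. j y (s y)) x v = j x (DS s x v) + \<tau>" "DE (\<lambda>y. j y (t y)) x w = j x (DS t x w) + \<rho>"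
    by (simp_all add: \<tau>_def \<rho>_def)
  have perp: "\<tau> \<in> perp x" "\<rho> \<in> perp x"
    unfolding \<tau>_def \<rho>_def using D_j_normal_perp[OF U] s t v w by blast+
  have fib: "DS s x v \<in> fiber S x" "DS t x w \<in> fiber S x"
    using connection_in_fiber[OF connection_S U] s t v w by blast+
  have "bQ x (sff x v (s x)) (sff x w (t x)) = bE x \<tau> \<rho>"
    unfolding sff_eq[OF U s v] sff_eq[OF U t w] using bQ_apply[OF perp] by (simp add: \<tau>_def \<rho>_def)
  then show ?thesis
    using perp fib j_in_fiber perp_in_fiber
      complex_vector.subspace_add[OF fiber_subspace[OF bundle_E]]
    unfolding D bS_apply
    by (simp add: hermitian_on_add_left[OF hermitian_E] hermitian_on_add_right[OF hermitian_E]
        perp_pairing_left perp_pairing_right)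
qed

theorem curvature_subbundle:
  assumes U: "open U" "x \<in> U" and \<alpha>: "smooth_field10 A U \<alpha>" and \<beta>: "smooth_field10 A U \<beta>"
    and s: "smooth_section A S U s" and t: "smooth_section A S U t"
  shows "curvature_tensor A bS DS \<alpha> \<beta> s t x =
    curvature_tensor A bE DE \<alpha> \<beta> (\<lambda>y. j y (s y)) (\<lambda>y. j y (t y)) x
    - bQ x (sff x (\<alpha> x) (s x)) (sff x (\<beta> x) (t x))"
proof -
  have \<alpha>x: "\<alpha> x \<in> tangent10 A x" and \<beta>x: "\<beta> x \<in> tangent10 A x"
    using smooth_field10_in_tangent10 \<alpha> \<beta> U by blast+
  then have \<alpha>\<beta>: "\<alpha> x \<in> tangent A x" "\<beta> x \<in> tangent A x" using tangent10_subset by blast+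
  have "bE x (DE (\<lambda>y. j y (s y)) x (conj_tvec (\<beta> x))) (DE (\<lambda>y. j y (t y)) x (conj_tvec (\<alpha> x)))
      = bS x (DS s x (conj_tvec (\<beta> x))) (DS t x (conj_tvec (\<alpha> x)))"
    by (simp only: bS_apply j_commutes_dbar[OF U s conj_tvec_tangent10[OF \<beta>x]]
        j_commutes_dbar[OF U t conj_tvec_tangent10[OF \<alpha>x]])
  then show ?thesis
    using pairing_D_j_D_j[OF U s t \<alpha>\<beta>]
      curvature_tensor_difference[OF bundle_S hermitian_S chern_S s t bundle_E hermitian_E
        chern_E j_section[OF U(1) s] j_section[OF U(1) t] U \<alpha> \<beta> pairing_D_j[OF U(1) _ s t]]
    by (simp add: algebra_simps)
qed

end


section \<open>The curvature of the quotient bundle\<close>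

locale hermitian_exact_sequence_adjoints = hermitian_exact_sequence A S E Q j q bS bE bQ DS DE DQ
  for A :: "('x::t2_space, 'n::finite) chart set"
    and S :: "('x, 's::complex_vector) vbundle"
    and E :: "('x, 'e::complex_vector) vbundle"
    and Q :: "('x, 'q::complex_vector) vbundle"
    and j q bS bE bQ DS DE DQ +
  fixes \<sigma>d :: "('x, 'q, 's) hom_form1" and qd :: "'x \<Rightarrow> 'q \<Rightarrow> 'e"
  assumes adjoint_sff: "is_adjoint_form10 A S bS Q bQ sff \<sigma>d"
    and adjoint_q: "is_adjoint A E bE Q bQ q qd"
begin

lemma qd_section: "open U \<Longrightarrow> smooth_section A Q U s \<Longrightarrow> smooth_section A E U (\<lambda>y. qd y (s y))"
  using adjoint_q unfolding is_adjoint_def smooth_morphism_def by blast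

lemma qd_in_fiber: "u \<in> fiber Q x \<Longrightarrow> qd x u \<in> fiber E x"
  using adjoint_q unfolding is_adjoint_def smooth_morphism_def clinear_between_def by blast

lemma qd_pairing_left: "u \<in> fiber Q x \<Longrightarrow> y \<in> fiber E x \<Longrightarrow> bE x (qd x u) y = bQ x u (q x y)"
  using adjoint_q unfolding is_adjoint_def by blast

lemma qd_pairing_right:
  assumes "u \<in> fiber Q x" "y \<in> fiber E x"
  shows "bE x y (qd x u) = bQ x (q x y) u"
  using hermitian_on_sym[OF hermitian_E qd_in_fiber[OF assms(1)] assms(2)]
    hermitian_on_sym[OF hermitian_Q assms(1) q_in_fiber[OF assms(2)]] qd_pairing_left[OF assms]
  by simp

lemma qd_perp:
  assumes "u \<in> fiber Q x"
  shows "qd x u \<in> perp x"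
proof -
  have "bQ x u 0 = cnj (bQ x 0 u)"
    using complex_vector.subspace_0[OF fiber_subspace[OF bundle_Q]]
    by (rule hermitian_on_sym[OF hermitian_Q _ assms])
  then have zero: "bQ x u 0 = 0" using hermitian_on_zero[OF hermitian_Q assms] by simp
  have "bE x (qd x u) (j x w) = 0" if w: "w \<in> fiber S x" for w
    using qd_pairing_left[OF assms j_in_fiber[OF w]] zero by (simp add: q_j[OF w])
  then show ?thesis using qd_in_fiber[OF assms] unfolding sub_perp_def by blast
qed

text \<open>The adjoint of \<open>q\<close> inverts \<open>q\<close> modulo the kernel of the form only.\<close>

lemma q_qd:
  assumes u: "u \<in> fiber Q x" and w: "w \<in> fiber Q x"
  shows "bQ x (q x (qd x u)) w = bQ x u w" "bQ x w (q x (qd x u)) = bQ x w u"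
proof -
  obtain w' where w': "w' \<in> perp x" "q x w' = w" using perp_lift[OF w] .
  have "bQ x (q x (qd x u)) (q x w') = bE x (qd x u) w'" using bQ_apply[OF qd_perp[OF u] w'(1)] .
  also have "\<dots> = bQ x u (q x w')" using qd_pairing_left[OF u perp_in_fiber[OF w'(1)]] .
  finally show *: "bQ x (q x (qd x u)) w = bQ x u w" unfolding w'(2) .
  show "bQ x w (q x (qd x u)) = bQ x w u"
    using * hermitian_on_sym[OF hermitian_Q q_in_fiber[OF qd_in_fiber[OF u]] w]
      hermitian_on_sym[OF hermitian_Q u w] by simp
qed

text \<open>For \<open>w\<close> in \<open>S\<^sup>\<bottom>\<close>, both \<open>w\<close> and \<open>q\<^sup>\<dagger> (q w)\<close> pair with \<open>y\<close> to \<open>b\<^sub>Q (q y, q w)\<close>, because the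
  part of \<open>y\<close> in \<open>S\<close> is orthogonal to \<open>w\<close> and is annihilated by \<open>q\<close>.\<close>

lemma perp_eq_qd_q:
  assumes w: "w \<in> perp x" and y: "y \<in> fiber E x"
  shows "bE x y w = bE x y (qd x (q x w))"
proof -
  note w' = perp_in_fiber[OF w]
  obtain u y' where y': "u \<in> fiber S x" "y' \<in> perp x" "y = j x u + y'"
    using fiber_decomposition[OF y] .
  have "bE x y w = bE x y' w"
    unfolding y'(3) using y' w w' j_in_fiber perp_in_fiber
    by (simp add: hermitian_on_add_left[OF hermitian_E] perp_pairing_right)
  also have "\<dots> = bQ x (q x y') (q x w)" using bQ_apply[OF y'(2) w] by simp
  also have "\<dots> = bQ x (q x y) (q x w)"
    unfolding y'(3) using y' j_in_fiber perp_in_fiber by (simp add: q_add q_j)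
  also have "\<dots> = bE x y (qd x (q x w))" using qd_pairing_right[OF q_in_fiber[OF w'] y] by simp
  finally show ?thesis .
qed

lemma pairing_qd_qd:
  assumes "u \<in> fiber Q x" "w \<in> fiber Q x"
  shows "bE x (qd x u) (qd x w) = bQ x u w"
  using qd_pairing_left[OF assms(1) qd_in_fiber[OF assms(2)]] q_qd(2)[OF assms(2,1)] by simp

text \<open>In direction \<open>(0,1)\<close>, \<open>q (D\<^sub>E (q\<^sup>\<dagger> s)) = D\<^sub>Q (q q\<^sup>\<dagger> s)\<close> as \<open>q\<close> is holomorphic, and \<open>q q\<^sup>\<dagger> s\<close> may
  be replaced by \<open>s\<close> under the form. Direction \<open>(1,0)\<close> follows by metric compatibility.\<close>

lemma pairing_D_qd:
  assumes U: "open U" "x \<in> U" and s: "smooth_section A Q U s" and t: "smooth_section A Q U t"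
    and v: "v \<in> tangent A x"
  shows "bE x (DE (\<lambda>y. qd y (s y)) x v) (qd x (t x)) = bQ x (DQ s x v) (t x)"
proof -
  have dbar: "bE x (DE (\<lambda>y. qd y (s y)) x v) (qd x (t x)) = bQ x (DQ s x v) (t x)"
    if s: "smooth_section A Q U s" and t: "smooth_section A Q U t" and v: "v \<in> tangent01 A x"
    for s t v
  proof -
    have v': "v \<in> tangent A x" using v tangent01_subset by blast
    note qds = qd_section[OF U(1) s]
    note fib = smooth_section_in_fiber[OF s] smooth_section_in_fiber[OF t]
    have "bE x (DE (\<lambda>y. qd y (s y)) x v) (qd x (t x)) = bQ x (DQ (\<lambda>y. q y (qd y (s y))) x v) (t x)"
      unfolding q_commutes_dbar[OF U qds v]
      by (rule qd_pairing_right[OF fib(2)[OF U(2)] connection_in_fiber[OF connection_E U qds v']])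
    also have "\<dots> = v (\<lambda>y. bQ y (q y (qd y (s y))) (t y))
        - bQ x (q x (qd x (s x))) (DQ t x (conj_tvec v))"
      using chern_connection_metric[OF chern_Q U q_section[OF U(1) qds] t v'] by simp
    also have "v (\<lambda>y. bQ y (q y (qd y (s y))) (t y)) = v (\<lambda>y. bQ y (s y) (t y))"
      by (rule tangent_local[OF v' U]) (rule q_qd(1)[OF fib])
    also have "bQ x (q x (qd x (s x))) (DQ t x (conj_tvec v)) = bQ x (s x) (DQ t x (conj_tvec v))"
      by (rule q_qd(1)[OF fib(1)[OF U(2)] connection_in_fiber[OF connection_Q U t
              conj_tvec_tangent[OF v']]])
    also have "v (\<lambda>y. bQ y (s y) (t y)) - bQ x (s x) (DQ t x (conj_tvec v)) = bQ x (DQ s x v) (t x)"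
      using chern_connection_metric[OF chern_Q U s t v'] by simp
    finally show ?thesis .
  qed
  note fib = smooth_section_in_fiber[OF s] smooth_section_in_fiber[OF t]
  have "bE x (DE (\<lambda>y. qd y (s y)) x v) (qd x (t x)) = bQ x (DQ s x v) (t x)"
    if v: "v \<in> tangent10 A x" for v
  proof -
    have v': "v \<in> tangent A x" "conj_tvec v \<in> tangent A x"
      using v tangent10_subset conj_tvec_tangent by blast+
    have "bE x (qd x (s x)) (DE (\<lambda>y. qd y (t y)) x (conj_tvec v)) = bQ x (s x) (DQ t x (conj_tvec v))"
      using dbar[OF t s conj_tvec_tangent10[OF v]]
        hermitian_on_sym[OF hermitian_E connection_in_fiber[OF connection_E U
            qd_section[OF U(1) t] v'(2)] qd_in_fiber[OF fib(1)[OF U(2)]]]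
        hermitian_on_sym[OF hermitian_Q connection_in_fiber[OF connection_Q U t v'(2)]
          fib(1)[OF U(2)]] by simp
    moreover have "v (\<lambda>y. bE y (qd y (s y)) (qd y (t y))) = v (\<lambda>y. bQ y (s y) (t y))"
      by (rule tangent_local[OF v'(1) U]) (rule pairing_qd_qd[OF fib])
    ultimately show ?thesis
      using chern_connection_metric[OF chern_E U qd_section[OF U(1) s] qd_section[OF U(1) t] v'(1)]
        chern_connection_metric[OF chern_Q U s t v'(1)] by simp
  qed
  from connection_pairing_eq_on_tangent[where b = bQ and b' = bE and D = DQ and D' = DE and x = x
      and s = s and s' = "\<lambda>y. qd y (s y)" and u = "t x" and u' = "qd x (t x)", OF hermitian_Q
      connection_Q s fib(2)[OF U(2)] hermitian_E connection_E qd_section[OF U(1) s]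
      qd_in_fiber[OF fib(2)[OF U(2)]] U this dbar[OF s t] v]
  show ?thesis .
qed

lemma pairing_D_qd_fiber:
  assumes U: "open U" "x \<in> U" and s: "smooth_section A Q U s" and v: "v \<in> tangent A x"
    and u: "u \<in> fiber Q x"
  shows "bE x (DE (\<lambda>y. qd y (s y)) x v) (qd x u) = bQ x (DQ s x v) u"
proof -
  obtain U' t where t: "open U'" "x \<in> U'" "smooth_section A Q U' t" "t x = u"
    using section_through[OF bundle_Q u] .
  have UU': "open (U \<inter> U')" "x \<in> U \<inter> U'" using U t by auto
  show ?thesis
    unfolding t(4)[symmetric]
    by (rule pairing_D_qd[OF UU' _ _ v])
      (auto intro: smooth_section_subset[OF s] smooth_section_subset[OF t(3)])
qed

text \<open>Differentiating \<open>b\<^sub>E (q\<^sup>\<dagger> s, j t) = 0\<close> computes the part of \<open>D\<^sub>E (q\<^sup>\<dagger> s)\<close> tangential to \<open>S\<close>.\<close>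

lemma pairing_D_qd_j:
  assumes U: "open U" "x \<in> U" and s: "smooth_section A Q U s" and u: "u \<in> fiber S x"
    and v: "v \<in> tangent10 A x"
  shows "bE x (DE (\<lambda>y. qd y (s y)) x v) (j x u) = 0"
    and "bE x (DE (\<lambda>y. qd y (s y)) x (conj_tvec v)) (j x u) = - bS x (\<sigma>d x (conj_tvec v) (s x)) u"
proof -
  obtain U' t where t: "open U'" "x \<in> U'" "smooth_section A S U' t" "t x = u"
    using section_through[OF bundle_S u] .
  define W where "W = U \<inter> U'"
  have W: "open W" "x \<in> W" using U t by (auto simp: W_def)
  have sW: "smooth_section A Q W s" and tW: "smooth_section A S W t"
    unfolding W_def using smooth_section_subset[OF s] smooth_section_subset[OF t(3)] by auto
  have v': "v \<in> tangent A x" "conj_tvec v \<in> tangent A x"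
    using v tangent10_subset conj_tvec_tangent by blast+
  have sx: "s x \<in> fiber Q x" using smooth_section_in_fiber[OF s U(2)] .
  note qdp = qd_perp[OF sx]
  have zero: "w (\<lambda>y. bE y (qd y (s y)) (j y (t y))) = 0" if w: "w \<in> tangent A x" for w
  proof -
    have zero_E: "smooth_section A E W (\<lambda>y. 0)"
      using smooth_section_combination[OF bundle_E W(1), of "{}"] by simp
    have "w (\<lambda>y. bE y (qd y (s y)) (j y (t y))) = w (\<lambda>y. 0)"
      by (rule tangent_local[OF w W])
        (use smooth_section_in_fiber[OF sW] smooth_section_in_fiber[OF tW] in
          \<open>blast intro: perp_pairing_left qd_perp\<close>)
    also have "\<dots> = 0" using tangent_zero[OF w] .
    finally show ?thesis .
  qed
  have leibniz: "bE x (DE (\<lambda>y. qd y (s y)) x w) (j x u) = - bE x (qd x (s x)) (DE (\<lambda>y. j y (t y)) x (conj_tvec w))"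
    if w: "w \<in> tangent A x" for w
    using chern_connection_metric[OF chern_E W qd_section[OF W(1) sW] j_section[OF W(1) tW] w]
      zero[OF w] t(4) by (simp add: eq_neg_iff_add_eq_0)
  have "bE x (qd x (s x)) (DE (\<lambda>y. j y (t y)) x (conj_tvec v)) = 0"
    unfolding j_commutes_dbar[OF W tW conj_tvec_tangent10[OF v]]
    by (rule perp_pairing_left[OF qdp connection_in_fiber[OF connection_S W tW v'(2)]])
  then show "bE x (DE (\<lambda>y. qd y (s y)) x v) (j x u) = 0" using leibniz[OF v'(1)] by simp
  have "bE x (qd x (s x)) (DE (\<lambda>y. j y (t y)) x v) = bQ x (s x) (q x (DE (\<lambda>y. j y (t y)) x v))"
    using qd_pairing_left[OF sx connection_in_fiber[OF connection_E W j_section[OF W(1) tW] v'(1)]] .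
  also have "q x (DE (\<lambda>y. j y (t y)) x v) = sff x v (t x)"
    using sff_eq[OF W tW v'(1)] connection_in_fiber[OF connection_E W j_section[OF W(1) tW] v'(1)]
      connection_in_fiber[OF connection_S W tW v'(1)]
    by (simp add: clinear_between_diff[OF q_clinear fiber_subspace[OF bundle_E]] j_in_fiber q_j)
  also have "bQ x (s x) (sff x v (t x)) = bS x (\<sigma>d x (conj_tvec v) (s x)) u"
    using adjoint_sff v sx u unfolding is_adjoint_form10_def t(4) by simp
  finally show "bE x (DE (\<lambda>y. qd y (s y)) x (conj_tvec v)) (j x u) = - bS x (\<sigma>d x (conj_tvec v) (s x)) u"
    using leibniz[OF v'(2)] unfolding conj_tvec_conj_tvec by simp
qed

lemma \<sigma>d_in_fiber:
  assumes "v \<in> tangent A x" "u \<in> fiber Q x"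
  shows "\<sigma>d x v u \<in> fiber S x"
proof -
  have "clinear_between (fiber Q x) (fiber S x) (\<sigma>d x v)"
    using adjoint_sff[unfolded is_adjoint_form10_def smooth_hom_form01_def, THEN conjunct1,
        THEN conjunct1] assms(1) by blast
  then show ?thesis using assms(2) unfolding clinear_between_def by blast
qed

text \<open>An arbitrary \<open>y\<close> is the sum of a part in \<open>S\<close>, against which \<open>D\<^sub>E (q\<^sup>\<dagger> s)\<close> was just computed,
  and a part in \<open>S\<^sup>\<bottom>\<close>, which may be replaced by a value of \<open>q\<^sup>\<dagger>\<close>.\<close>

lemma D_qd_mod_kernel:
  assumes U: "open U" "x \<in> U" and s: "smooth_section A Q U s" and y: "y \<in> fiber E x"
    and v: "v \<in> tangent10 A x"
  shows "bE x (DE (\<lambda>y. qd y (s y)) x v) y = bE x (qd x (DQ s x v)) y"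
    and "bE x (DE (\<lambda>y. qd y (s y)) x (conj_tvec v)) y
      = bE x (qd x (DQ s x (conj_tvec v)) - j x (\<sigma>d x (conj_tvec v) (s x))) y"
proof -
  obtain u y' where y': "u \<in> fiber S x" "y' \<in> perp x" "y = j x u + y'"
    using fiber_decomposition[OF y] .
  have v': "v \<in> tangent A x" "conj_tvec v \<in> tangent A x"
    using v tangent10_subset conj_tvec_tangent by blast+
  have fib: "j x u \<in> fiber E x" "y' \<in> fiber E x" "q x y' \<in> fiber Q x" "s x \<in> fiber Q x"
    using j_in_fiber y' perp_in_fiber q_in_fiber smooth_section_in_fiber[OF s U(2)] by blast+
  have split: "bE x (DE (\<lambda>y. qd y (s y)) x w) y
      = bE x (DE (\<lambda>y. qd y (s y)) x w) (j x u) + bE x (qd x (DQ s x w)) y" if w: "w \<in> tangent A x" for w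
  proof -
    note D = connection_in_fiber[OF connection_E U qd_section[OF U(1) s] w]
    note DQ = connection_in_fiber[OF connection_Q U s w]
    have "bE x (DE (\<lambda>y. qd y (s y)) x w) y' = bQ x (DQ s x w) (q x y')"
      unfolding perp_eq_qd_q[OF y'(2) D] by (rule pairing_D_qd_fiber[OF U s w fib(3)])
    also have "\<dots> = bE x (qd x (DQ s x w)) y'" using qd_pairing_left[OF DQ fib(2)] by simp
    also have "\<dots> = bE x (qd x (DQ s x w)) y"
      unfolding y'(3) using fib perp_pairing_left[OF qd_perp[OF DQ] y'(1)]
      by (simp add: hermitian_on_add_right[OF hermitian_E] qd_in_fiber[OF DQ])
    finally show ?thesis
      unfolding y'(3) using D fib by (simp add: hermitian_on_add_right[OF hermitian_E])
  qed
  show "bE x (DE (\<lambda>y. qd y (s y)) x v) y = bE x (qd x (DQ s x v)) y"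
    using split[OF v'(1)] pairing_D_qd_j(1)[OF U s y'(1) v] by simp
  let ?\<sigma> = "\<sigma>d x (conj_tvec v) (s x)"
  have \<sigma>: "?\<sigma> \<in> fiber S x" using \<sigma>d_in_fiber[OF v'(2) fib(4)] .
  have "bS x ?\<sigma> u = bE x (j x ?\<sigma>) y"
    unfolding bS_apply y'(3) using fib j_in_fiber[OF \<sigma>] perp_pairing_right[OF y'(2) \<sigma>]
    by (simp add: hermitian_on_add_right[OF hermitian_E])
  then show "bE x (DE (\<lambda>y. qd y (s y)) x (conj_tvec v)) y
      = bE x (qd x (DQ s x (conj_tvec v)) - j x ?\<sigma>) y"
    using split[OF v'(2)] pairing_D_qd_j(2)[OF U s y'(1) v]
      hermitian_on_diff_left[OF hermitian_E qd_in_fiber[OF connection_in_fiber[OF connection_Q U s v'(2)]]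
        j_in_fiber[OF \<sigma>] y] by simp
qed

text \<open>Terms in the kernel of the form drop out of the pairings, and so do the mixed terms, since
  \<open>q\<^sup>\<dagger>\<close> takes values in \<open>S\<^sup>\<bottom>\<close>.\<close>

lemma pairing_D_qd_D_qd:
  assumes U: "open U" "x \<in> U" and s: "smooth_section A Q U s" and t: "smooth_section A Q U t"
    and v: "v \<in> tangent10 A x" and w: "w \<in> tangent10 A x"
  shows "bE x (DE (\<lambda>y. qd y (s y)) x v) (DE (\<lambda>y. qd y (t y)) x w) = bQ x (DQ s x v) (DQ t x w)"
    and "bE x (DE (\<lambda>y. qd y (s y)) x (conj_tvec v)) (DE (\<lambda>y. qd y (t y)) x (conj_tvec w))
      = bQ x (DQ s x (conj_tvec v)) (DQ t x (conj_tvec w))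
        + bS x (\<sigma>d x (conj_tvec v) (s x)) (\<sigma>d x (conj_tvec w) (t x))"
proof -
  have v': "v \<in> tangent A x" "conj_tvec v \<in> tangent A x"
    and w': "w \<in> tangent A x" "conj_tvec w \<in> tangent A x"
    using v w tangent10_subset conj_tvec_tangent by blast+
  have sx: "s x \<in> fiber Q x" and tx: "t x \<in> fiber Q x"
    using smooth_section_in_fiber[OF s U(2)] smooth_section_in_fiber[OF t U(2)] .
  have Dt: "DE (\<lambda>y. qd y (t y)) x z \<in> fiber E x" "DQ t x z \<in> fiber Q x" if "z \<in> tangent A x" for z
    using connection_in_fiber[OF connection_E U qd_section[OF U(1) t] that]
      connection_in_fiber[OF connection_Q U t that] .
  have DQs: "DQ s x z \<in> fiber Q x" if "z \<in> tangent A x" for z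
    using connection_in_fiber[OF connection_Q U s that] .
  have "bE x (DE (\<lambda>y. qd y (s y)) x v) (DE (\<lambda>y. qd y (t y)) x w)
      = bE x (qd x (DQ s x v)) (DE (\<lambda>y. qd y (t y)) x w)"
    by (rule D_qd_mod_kernel(1)[OF U s Dt(1)[OF w'(1)] v])
  also have "\<dots> = bE x (qd x (DQ s x v)) (qd x (DQ t x w))"
    using D_qd_mod_kernel(1)[OF U t qd_in_fiber[OF DQs[OF v'(1)]] w]
      hermitian_on_sym[OF hermitian_E Dt(1)[OF w'(1)] qd_in_fiber[OF DQs[OF v'(1)]]]
      hermitian_on_sym[OF hermitian_E qd_in_fiber[OF Dt(2)[OF w'(1)]] qd_in_fiber[OF DQs[OF v'(1)]]]
    by simp
  also have "\<dots> = bQ x (DQ s x v) (DQ t x w)" by (rule pairing_qd_qd[OF DQs[OF v'(1)] Dt(2)[OF w'(1)]])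
  finally show "bE x (DE (\<lambda>y. qd y (s y)) x v) (DE (\<lambda>y. qd y (t y)) x w) = bQ x (DQ s x v) (DQ t x w)" .
  define a b where "a = \<sigma>d x (conj_tvec v) (s x)" and "b = \<sigma>d x (conj_tvec w) (t x)"
  have ab: "a \<in> fiber S x" "b \<in> fiber S x"
    unfolding a_def b_def using \<sigma>d_in_fiber v'(2) w'(2) sx tx by blast+
  define c d where "c = qd x (DQ s x (conj_tvec v))" and "d = qd x (DQ t x (conj_tvec w))"
  have perp: "c \<in> perp x" "d \<in> perp x"
    unfolding c_def d_def using qd_perp DQs[OF v'(2)] Dt(2)[OF w'(2)] by blast+
  note fib = perp[THEN perp_in_fiber] ab[THEN j_in_fiber]
  have cd: "c - j x a \<in> fiber E x" "d - j x b \<in> fiber E x"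
    using complex_vector.subspace_diff[OF fiber_subspace[OF bundle_E]] fib by blast+
  have "bE x (DE (\<lambda>y. qd y (s y)) x (conj_tvec v)) (DE (\<lambda>y. qd y (t y)) x (conj_tvec w))
      = bE x (c - j x a) (DE (\<lambda>y. qd y (t y)) x (conj_tvec w))"
    unfolding a_def c_def by (rule D_qd_mod_kernel(2)[OF U s Dt(1)[OF w'(2)] v])
  also have "\<dots> = bE x (c - j x a) (d - j x b)"
    using D_qd_mod_kernel(2)[OF U t cd(1) w, folded d_def b_def]
      hermitian_on_sym[OF hermitian_E Dt(1)[OF w'(2)] cd(1)] hermitian_on_sym[OF hermitian_E cd(2,1)]
    by simp
  also have "\<dots> = bE x c d + bE x (j x a) (j x b)"
    using fib cd perp_pairing_left[OF perp(1) ab(2)] perp_pairing_right[OF perp(2) ab(1)]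
    by (simp add: hermitian_on_diff_left[OF hermitian_E] hermitian_on_diff_right[OF hermitian_E])
  also have "bE x c d = bQ x (DQ s x (conj_tvec v)) (DQ t x (conj_tvec w))"
    unfolding c_def d_def by (rule pairing_qd_qd[OF DQs[OF v'(2)] Dt(2)[OF w'(2)]])
  finally show "bE x (DE (\<lambda>y. qd y (s y)) x (conj_tvec v)) (DE (\<lambda>y. qd y (t y)) x (conj_tvec w))
      = bQ x (DQ s x (conj_tvec v)) (DQ t x (conj_tvec w))
        + bS x (\<sigma>d x (conj_tvec v) (s x)) (\<sigma>d x (conj_tvec w) (t x))"
    unfolding bS_apply a_def b_def .
qed

theorem curvature_quotient:
  assumes U: "open U" "x \<in> U" and \<alpha>: "smooth_field10 A U \<alpha>" and \<beta>: "smooth_field10 A U \<beta>"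
    and s: "smooth_section A Q U s" and t: "smooth_section A Q U t"
  shows "curvature_tensor A bQ DQ \<alpha> \<beta> s t x =
    curvature_tensor A bE DE \<alpha> \<beta> (\<lambda>y. qd y (s y)) (\<lambda>y. qd y (t y)) x
    + bS x (\<sigma>d x (conj_tvec (\<beta> x)) (s x)) (\<sigma>d x (conj_tvec (\<alpha> x)) (t x))"
proof -
  have \<alpha>x: "\<alpha> x \<in> tangent10 A x" and \<beta>x: "\<beta> x \<in> tangent10 A x"
    using smooth_field10_in_tangent10 \<alpha> \<beta> U by blast+
  show ?thesis
    using curvature_tensor_difference[OF bundle_Q hermitian_Q chern_Q s t bundle_E hermitian_E
        chern_E qd_section[OF U(1) s] qd_section[OF U(1) t] U \<alpha> \<beta> pairing_D_qd[OF U(1) _ s t]]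
    unfolding pairing_D_qd_D_qd(1)[OF U s t \<alpha>x \<beta>x] pairing_D_qd_D_qd(2)[OF U s t \<beta>x \<alpha>x]
    by (simp add: algebra_simps)
qed

end


theorem corollary2p15:
  fixes A :: "('x::t2_space, 'n::finite) chart set"
    and S :: "('x, 's::complex_vector) vbundle"
    and E :: "('x, 'e::complex_vector) vbundle"
    and Q :: "('x, 'q::complex_vector) vbundle"
    and j :: "'x \<Rightarrow> 's \<Rightarrow> 'e" and q :: "'x \<Rightarrow> 'e \<Rightarrow> 'q"
    and bS :: "('x, 's) form" and bE :: "('x, 'e) form" and bQ :: "('x, 'q) form"
    and DS :: "('x \<Rightarrow> 's) \<Rightarrow> ('x, 's) vform1"
    and DE :: "('x \<Rightarrow> 'e) \<Rightarrow> ('x, 'e) vform1"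
    and DQ :: "('x \<Rightarrow> 'q) \<Rightarrow> ('x, 'q) vform1"
    and \<sigma> :: "('x, 's, 'q) hom_form1" and \<sigma>d :: "('x, 'q, 's) hom_form1"
    and qd :: "'x \<Rightarrow> 'q \<Rightarrow> 'e"
  assumes "complex_manifold A"
    and "holomorphic_bundle A S" and "holomorphic_bundle A E" and "holomorphic_bundle A Q"
    and "short_exact_sequence A S E Q j q"
    and "smooth_hermitian_form A E bE"
    and "\<And>x. {u + v | u v. u \<in> j x ` fiber S x \<and> v \<in> sub_perp S E j bE x} = fiber E x"
    and "\<And>x. j x ` fiber S x \<inter> sub_perp S E j bE x = j x ` fiber S x \<inter> form_kernel E bE x"
    and "bS = pullback_form j bE" and "bQ = quotient_form S E j q bE"
    and "chern_connection A S bS DS" and "chern_connection A E bE DE"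
    and "chern_connection A Q bQ DQ"
    and "\<sigma> = second_fundamental_form A S j q DS DE"
    and "is_adjoint_form10 A S bS Q bQ \<sigma> \<sigma>d"
    and "is_adjoint A E bE Q bQ q qd"
  shows "(\<forall>U \<alpha> \<beta> s t. open U \<and> smooth_field10 A U \<alpha> \<and> smooth_field10 A U \<beta> \<and>
            smooth_section A S U s \<and> smooth_section A S U t \<longrightarrow>
            (\<forall>x\<in>U. curvature_tensor A bS DS \<alpha> \<beta> s t x =
               curvature_tensor A bE DE \<alpha> \<beta> (\<lambda>y. j y (s y)) (\<lambda>y. j y (t y)) x
               - bQ x (\<sigma> x (\<alpha> x) (s x)) (\<sigma> x (\<beta> x) (t x)))) \<and>
         (\<forall>U \<alpha> \<beta> s t. open U \<and> smooth_field10 A U \<alpha> \<and> smooth_field10 A U \<beta> \<and>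
            smooth_section A Q U s \<and> smooth_section A Q U t \<longrightarrow>
            (\<forall>x\<in>U. curvature_tensor A bQ DQ \<alpha> \<beta> s t x =
               curvature_tensor A bE DE \<alpha> \<beta> (\<lambda>y. qd y (s y)) (\<lambda>y. qd y (t y)) x
               + bS x (\<sigma>d x (conj_tvec (\<beta> x)) (s x)) (\<sigma>d x (conj_tvec (\<alpha> x)) (t x))))"
proof -
  have adjoint: "is_adjoint_form10 A S bS Q bQ (second_fundamental_form A S j q DS DE) \<sigma>d"
    using assms(14,15) by simp
  interpret hermitian_exact_sequence_adjoints A S E Q j q bS bE bQ DS DE DQ \<sigma>d qd
    by (unfold_locales; (fact assms | fact adjoint))
  show ?thesis
    unfolding assms(14)
    by (intro conjI allI impI ballI; elim conjE; (rule curvature_subbundle | rule curvature_quotient);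
        assumption)
qed

end
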